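(* Let $\theta_1,\ldots,\theta_N$ be i.i.d. uniform on $[0,1]$, $\mathbf{V}$ the $N\times N$ random Vandermonde matrix with these phases, and $\lambda_1(N)$ the smallest eigenvalue of $\mathbf{V}^*\mathbf{V}$. Let $\gamma=\log\big(\cos(\pi/8)/\sin(\pi/8)\big)$. Then for every $\epsilon\in(0,1)$ and all sufficiently large $N$, $$\mathbb{P}\Big(\lambda_1(N)\le4N^2\exp\big(-\sqrt{\gamma\pi}\,\epsilon\sqrt N/2\big)\Big)\ge1-\epsilon.$$
   Context: The $N\times N$ Vandermonde matrix has entries $V(j,q)=\frac{1}{\sqrt N}e^{2\pi i (j-1)\theta_q}$, $j,q=1,\ldots,N$. *)

theory Defs
  imports "HOL-Probability.Probability" "Jordan_Normal_Form.Schur_Decomposition"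
begin

definition vandermonde :: "nat \<Rightarrow> (nat \<Rightarrow> real) \<Rightarrow> complex mat" where
  "vandermonde N \<theta> = mat N N (\<lambda>(j, q).
      exp (2 * of_real pi * \<i> * of_nat j * of_real (\<theta> q)) / of_real (sqrt (real N)))"

text \<open>Smallest eigenvalue of a Hermitian matrix (its eigenvalues are real).\<close>
definition smallest_eigenvalue :: "complex mat \<Rightarrow> real" where
  "smallest_eigenvalue A = Min (Re ` {k. eigenvalue A k})"

definition phase_space :: "nat \<Rightarrow> (nat \<Rightarrow> real) measure" where
  "phase_space N = PiM {..<N} (\<lambda>_. uniform_measure lborel {0..1})"

definition lambda1 :: "nat \<Rightarrow> (nat \<Rightarrow> real) \<Rightarrow> real" where
  "lambda1 N \<theta> = smallest_eigenvalue (mat_adjoint (vandermonde N \<theta>) * vandermonde N \<theta>)"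

end

(*
Write z_q = exp(2 pi i theta_q) and P(w) = prod_q (w - z_q). Lagrange interpolation of w^j gives
sum_q z_q^j / (P'(z_q) (w - z_q)) = w^j / P(w) for j < N. Hence u_q = 1 / (P'(z_q) (w1 - z_q)) satisfies
|V u| = 1 / |P(w1)|, while the identity for j = 0 at a second point w0 and Cauchy-Schwarz bound
sum_q 1 / |P'(z_q)|^2, and so |u|^2, from below. The outcome is
lambda_1 <= 4 |P(w0)|^2 / |P(w1)|^2 * sum_q 1 / |w0 - z_q|^2.
For w0, w1 = 1, -1 (in the better order) the ratio of the |P|'s is exp(-|S|), where S is the sum of the
X_q = ln |tan(pi theta_q)|, which are i.i.d. and symmetric with exponential tails. By the central limit
theorem |S| is of order at least epsilon * sqrt N with probability 1 - epsilon, and gamma^2 / 4 is a lower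
bound for Var X_q good enough for the constant: |X_q| >= gamma when theta_q is within 1/8 of a multiple of 1/2.
*)
theory Submission
  imports Defs "HOL-Real_Asymp.Real_Asymp"
begin

subsection \<open>Rayleigh quotients of Gram matrices\<close>

text \<open>Three obstacles shape the proof. First, the sum of 1 / |w0 - z_q|^2 has infinite mean,
  because a single phase may fall close to w0. It is therefore bounded only while all |X_q| stay
  below a small multiple of sqrt N, which costs a factor exp(2 max |X_q|). This cost is covered by
  numerical slack: bounding the normal density by its peak, P(|S| <= tau sqrt N) is asymptotically
  at most 2 tau / (sigma sqrt(2 pi)); at the tau matching the claimed exponent and with sigma >=
  gamma / 2 this is at most eps / sqrt(2 gamma), and 2 gamma >= 4/3 leaves room to enlarge tau by
  9/8. Second, the event about \<open>lambda1\<close> has to be shown measurable, since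
  \<open>measure\<close> is 0 off the sigma-algebra. Test vectors bound \<open>lambda1\<close> from
  above; measurability also needs a vector that attains it. Vectors are plain functions because
  \<open>nat => complex\<close> has a topology with a countable dense set. Third, the central limit
  theorem speaks of one probability space, while \<open>phase_space N\<close> changes with N; hence
  the detour through infinite sequences of phases.\<close>

definition mat_app :: "nat \<Rightarrow> (nat \<Rightarrow> nat \<Rightarrow> complex) \<Rightarrow> (nat \<Rightarrow> complex) \<Rightarrow> nat \<Rightarrow> complex" where
  "mat_app n A u i = (\<Sum>j<n. A i j * u j)"

definition sqnorm :: "nat \<Rightarrow> (nat \<Rightarrow> complex) \<Rightarrow> real" where
  "sqnorm n u = (\<Sum>i<n. (cmod (u i))\<^sup>2)"

definition qform :: "nat \<Rightarrow> (nat \<Rightarrow> nat \<Rightarrow> complex) \<Rightarrow> (nat \<Rightarrow> complex) \<Rightarrow> real" where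
  "qform n A u = Re (\<Sum>i<n. mat_app n A u i * cnj (u i))"

lemma sqnorm_nonneg [simp]: "0 \<le> sqnorm n u"
  by (simp add: sqnorm_def sum_nonneg)

lemma norm_le_sqrt_sqnorm: "i < n \<Longrightarrow> cmod (u i) \<le> sqrt (sqnorm n u)"
  by (intro real_le_rsqrt) (auto simp: sqnorm_def intro!: member_le_sum)

lemma sqnorm_pos: "i < n \<Longrightarrow> u i \<noteq> 0 \<Longrightarrow> 0 < sqnorm n u"
  unfolding sqnorm_def by (rule sum_pos2[of _ i]) auto

lemma sqnorm_scale: "sqnorm n (\<lambda>i. c * u i) = (cmod c)\<^sup>2 * sqnorm n u"
  by (simp add: sqnorm_def norm_mult power_mult_distrib sum_distrib_left)

lemma of_real_sqnorm: "of_real (sqnorm n u) = (\<Sum>i<n. u i * cnj (u i))"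
  by (simp only: sqnorm_def of_real_sum complex_norm_square)

lemma norm_mat_app_le:
  "cmod (mat_app n A u i) \<le> (\<Sum>j<n. cmod (A i j)) * sqrt (sqnorm n u)"
proof -
  have "cmod (mat_app n A u i) \<le> (\<Sum>j<n. cmod (A i j) * cmod (u j))"
    unfolding mat_app_def by (rule order_trans[OF norm_sum]) (simp add: norm_mult)
  also have "\<dots> \<le> (\<Sum>j<n. cmod (A i j) * sqrt (sqnorm n u))"
    by (intro sum_mono mult_left_mono norm_le_sqrt_sqnorm) auto
  finally show ?thesis by (simp add: sum_distrib_right)
qed

lemma sqnorm_mat_app_bound: "\<exists>C>0. \<forall>u. sqnorm n (mat_app n A u) \<le> C * sqnorm n u"
proof -
  define C where "C = (\<Sum>i<n. (\<Sum>j<n. cmod (A i j))\<^sup>2)"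
  \<comment> \<open>The summand 1 keeps the constant positive even for the zero matrix;
    \<open>qform_coercive\<close> divides by it.\<close>
  have "sqnorm n (mat_app n A u) \<le> (C + 1) * sqnorm n u" for u
  proof -
    have "sqnorm n (mat_app n A u) \<le> (\<Sum>i<n. ((\<Sum>j<n. cmod (A i j)) * sqrt (sqnorm n u))\<^sup>2)"
      unfolding sqnorm_def[of n "mat_app n A u"] by (intro sum_mono power_mono norm_mat_app_le) auto
    also have "\<dots> = C * sqnorm n u"
      unfolding C_def sum_distrib_right[of "\<lambda>i. (\<Sum>j<n. cmod (A i j))\<^sup>2"] by (simp add: power_mult_distrib)
    also have "\<dots> \<le> (C + 1) * sqnorm n u" by (intro mult_right_mono) auto
    finally show ?thesis .
  qed
  moreover have "C + 1 > 0" unfolding C_def by (intro add_nonneg_pos sum_nonneg) auto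
  ultimately show ?thesis by blast
qed

lemma qform_bound: "\<exists>C>0. \<forall>u. qform n A u \<le> C * sqnorm n u"
proof -
  define C where "C = (\<Sum>i<n. (\<Sum>j<n. cmod (A i j)))"
  have "qform n A u \<le> (C + 1) * sqnorm n u" for u
  proof -
    have "qform n A u \<le> cmod (\<Sum>i<n. mat_app n A u i * cnj (u i))"
      unfolding qform_def by (rule complex_Re_le_cmod)
    also have "\<dots> \<le> (\<Sum>i<n. cmod (mat_app n A u i) * cmod (u i))"
      by (rule order_trans[OF norm_sum]) (simp add: norm_mult)
    also have "\<dots> \<le> (\<Sum>i<n. ((\<Sum>j<n. cmod (A i j)) * sqrt (sqnorm n u)) * sqrt (sqnorm n u))"
      by (intro sum_mono mult_mono norm_mat_app_le norm_le_sqrt_sqnorm mult_nonneg_nonneg sum_nonneg) auto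
    also have "\<dots> = C * sqnorm n u"
      by (simp add: C_def sum_distrib_right mult.assoc)
    also have "\<dots> \<le> (C + 1) * sqnorm n u" by (intro mult_right_mono) auto
    finally show ?thesis .
  qed
  moreover have "C + 1 > 0" unfolding C_def by (intro add_nonneg_pos sum_nonneg) auto
  ultimately show ?thesis by blast
qed

text \<open>Minimising \<open>s \<mapsto> \<langle>B (u - s B u), u - s B u\<rangle> \<ge> 0\<close> over real \<open>s\<close> bounds \<open>\<parallel>B u\<parallel>\<^sup>2\<close> by the form;
  this replaces a compactness argument.\<close>
lemma qform_coercive:
  assumes herm: "\<And>i j. i < n \<Longrightarrow> j < n \<Longrightarrow> B j i = cnj (B i j)"
    and pos: "\<And>u. 0 \<le> qform n B u"
    and inv: "\<And>u i. i < n \<Longrightarrow> mat_app n G (mat_app n B u) i = u i"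
  shows "\<exists>c>0. \<forall>u. c * sqnorm n u \<le> qform n B u"
proof -
  obtain C where C: "C > 0" "\<And>u. qform n B u \<le> C * sqnorm n u"
    using qform_bound by blast
  obtain D where D: "D > 0" "\<And>u. sqnorm n (mat_app n G u) \<le> D * sqnorm n u"
    using sqnorm_mat_app_bound by blast
  have "1 / (C * D) * sqnorm n u \<le> qform n B u" for u
  proof -
    define w where "w = mat_app n B u"
    \<comment> \<open>As the form at \<open>w\<close> is at most \<open>C * sqnorm n w\<close>, the
      quadratic in s is bounded by form(u) - 2 s |w|^2 + s^2 C |w|^2, which is smallest at s = 1 /
      C.\<close>
    define s :: complex where "s = of_real (1 / C)"
    have lin: "mat_app n B (\<lambda>i. u i - s * w i) i = w i - s * mat_app n B w i" for i
      by (simp add: mat_app_def w_def algebra_simps sum_subtractf sum_distrib_left)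
    have sym: "(\<Sum>i<n. mat_app n B w i * cnj (u i)) = (\<Sum>i<n. w i * cnj (w i))"
    proof -
      have "(\<Sum>i<n. mat_app n B w i * cnj (u i)) = (\<Sum>i<n. \<Sum>j<n. B i j * w j * cnj (u i))"
        by (simp add: mat_app_def sum_distrib_right)
      also have "\<dots> = (\<Sum>j<n. \<Sum>i<n. B i j * w j * cnj (u i))"
        by (rule sum.swap)
      also have "\<dots> = (\<Sum>j<n. \<Sum>i<n. w j * cnj (B j i * u i))"
      proof (intro sum.cong refl)
        fix i j assume "j \<in> {..<n}" "i \<in> {..<n}"
        then have "B i j = cnj (B j i)" by (intro herm) auto
        then show "B i j * w j * cnj (u i) = w j * cnj (B j i * u i)"
          by (simp add: mult_ac)
      qed
      also have "\<dots> = (\<Sum>j<n. w j * cnj (w j))"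
        by (simp add: w_def mat_app_def sum_distrib_left)
      finally show ?thesis .
    qed
    have "(\<Sum>i<n. mat_app n B (\<lambda>i. u i - s * w i) i * cnj (u i - s * w i))
        = (\<Sum>i<n. w i * cnj (u i)) - cnj s * (\<Sum>i<n. w i * cnj (w i))
          - s * (\<Sum>i<n. mat_app n B w i * cnj (u i)) + s * cnj s * (\<Sum>i<n. mat_app n B w i * cnj (w i))"
    proof -
      have "mat_app n B (\<lambda>i. u i - s * w i) i * cnj (u i - s * w i) = w i * cnj (u i) - cnj s * (w i * cnj (w i))
          - s * (mat_app n B w i * cnj (u i)) + s * cnj s * (mat_app n B w i * cnj (w i))" for i
        unfolding lin by (simp add: algebra_simps)
      then show ?thesis
        by (simp only: sum_subtractf sum.distrib sum_distrib_left)
    qed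
    then have "qform n B (\<lambda>i. u i - s * w i)
        = qform n B u - 2 / C * sqnorm n w + 1 / C^2 * qform n B w"
      unfolding sym of_real_sqnorm[symmetric]
      by (simp add: qform_def w_def[symmetric] s_def power2_eq_square flip: of_real_mult)
    then have "0 \<le> qform n B u - 2 / C * sqnorm n w + 1 / C^2 * qform n B w"
      using pos by metis
    also have "\<dots> \<le> qform n B u - 2 / C * sqnorm n w + 1 / C^2 * (C * sqnorm n w)"
      by (intro add_left_mono mult_left_mono C) auto
    also have "\<dots> = qform n B u - 1 / C * sqnorm n w"
      using C(1) by (simp add: power2_eq_square field_simps)
    finally have *: "sqnorm n w \<le> C * qform n B u"
      using C(1) by (simp add: field_simps)
    \<comment> \<open>Invertibility enters here: it turns control of |B u| into control of
      |u|.\<close>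
    have "sqnorm n u = sqnorm n (mat_app n G w)"
      unfolding sqnorm_def w_def by (intro sum.cong) (simp_all add: inv)
    also have "\<dots> \<le> D * (C * qform n B u)"
      using D(2)[of w] * D(1) by (meson mult_left_mono order_trans less_imp_le)
    finally show ?thesis using C D by (simp add: field_simps)
  qed
  then show ?thesis using C(1) D(1) by (intro exI[of _ "1 / (C * D)"]) auto
qed

lemma sqnorm_eq_0_iff: "sqnorm n u = 0 \<longleftrightarrow> (\<forall>i<n. u i = 0)"
  unfolding sqnorm_def by (subst sum_nonneg_eq_0_iff) auto

section \<open>Gram matrices and their eigenvalues\<close>

lemma mult_mat_vec_eq_mat_app:
  assumes "A \<in> carrier_mat n n" "v \<in> carrier_vec n" "i < n"
  shows "(A *\<^sub>v v) $ i = mat_app n (\<lambda>i j. A $$ (i, j)) (($) v) i"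
  using assms by (auto simp: mat_app_def scalar_prod_def atLeast0LessThan)

lemma gram_entry:
  fixes M :: "complex mat"
  assumes "M \<in> carrier_mat n n" "i < n" "j < n"
  shows "(mat_adjoint M * M) $$ (i, j) = (\<Sum>k<n. cnj (M $$ (k, i)) * M $$ (k, j))"
  using assms by (auto simp: mat_adjoint_def mat_of_rows_def scalar_prod_def atLeast0LessThan)

lemma gram_carrier:
  fixes M :: "complex mat"
  assumes "M \<in> carrier_mat n n"
  shows "mat_adjoint M * M \<in> carrier_mat n n"
  using assms by (auto simp: mat_adjoint_def)

lemma gram_form:
  fixes M :: "complex mat"
  assumes M: "M \<in> carrier_mat n n"
  shows "(\<Sum>i<n. mat_app n (\<lambda>i j. (mat_adjoint M * M) $$ (i, j)) u i * cnj (u i))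
       = of_real (sqnorm n (mat_app n (\<lambda>i j. M $$ (i, j)) u))"
proof -
  have "(\<Sum>i<n. mat_app n (\<lambda>i j. (mat_adjoint M * M) $$ (i, j)) u i * cnj (u i))
      = (\<Sum>i<n. \<Sum>j<n. \<Sum>k<n. cnj (M $$ (k, i) * u i) * (M $$ (k, j) * u j))"
    unfolding mat_app_def sum_distrib_right
    by (intro sum.cong refl)
       (simp add: gram_entry[OF M] sum_distrib_left sum_distrib_right mult_ac del: index_mult_mat)
  also have "\<dots> = (\<Sum>i<n. \<Sum>k<n. \<Sum>j<n. cnj (M $$ (k, i) * u i) * (M $$ (k, j) * u j))"
    by (intro sum.cong refl sum.swap)
  also have "\<dots> = (\<Sum>k<n. \<Sum>i<n. \<Sum>j<n. cnj (M $$ (k, i) * u i) * (M $$ (k, j) * u j))"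
    by (rule sum.swap)
  also have "\<dots> = (\<Sum>k<n. (\<Sum>j<n. M $$ (k, j) * u j) * cnj (\<Sum>i<n. M $$ (k, i) * u i))"
    by (simp add: cnj_sum sum_product sum_distrib_left sum_distrib_right mult_ac)
  finally show ?thesis by (simp add: of_real_sqnorm mat_app_def)
qed

text \<open>Pairing the eigenvector equation with the eigenvector v itself gives |M v|^2 = k |v|^2.
  The real part appears because \<open>smallest_eigenvalue\<close> is a minimum of real
  parts.\<close>

lemma gram_eigenvalue:
  fixes M :: "complex mat"
  assumes M: "M \<in> carrier_mat n n" and ev: "eigenvalue (mat_adjoint M * M) k"
  shows "\<exists>u. sqnorm n u > 0 \<and> sqnorm n (mat_app n (\<lambda>i j. M $$ (i, j)) u) = Re k * sqnorm n u"
proof -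
  let ?A = "mat_adjoint M * M"
  have A: "?A \<in> carrier_mat n n" by (rule gram_carrier[OF M])
  then obtain v where v: "v \<in> carrier_vec n" "v \<noteq> 0\<^sub>v n" "?A *\<^sub>v v = k \<cdot>\<^sub>v v"
    using ev unfolding eigenvalue_def eigenvector_def by (metis carrier_matD(1))
  have pos: "sqnorm n (($) v) > 0"
  proof -
    obtain i where "i < n" "v $ i \<noteq> 0"
      using v(1,2) by (metis eq_vecI carrier_vecD index_zero_vec(1) index_zero_vec(2))
    then show ?thesis by (rule sqnorm_pos)
  qed
  have "of_real (sqnorm n (mat_app n (\<lambda>i j. M $$ (i, j)) (($) v)))
      = (\<Sum>i<n. mat_app n (\<lambda>i j. ?A $$ (i, j)) (($) v) i * cnj (v $ i))"
    by (rule gram_form[OF M, symmetric])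
  also have "\<dots> = (\<Sum>i<n. (?A *\<^sub>v v) $ i * cnj (v $ i))"
    by (intro sum.cong refl) (simp add: mult_mat_vec_eq_mat_app[OF A v(1)] del: index_mult_mat_vec)
  also have "\<dots> = k * of_real (sqnorm n (($) v))"
    unfolding v(3) of_real_sqnorm using v(1) by (simp add: sum_distrib_left mult_ac)
  finally have "sqnorm n (mat_app n (\<lambda>i j. M $$ (i, j)) (($) v)) = Re (k * of_real (sqnorm n (($) v)))"
    by (metis Re_complex_of_real)
  then show ?thesis using pos by auto
qed

text \<open>Supplies the invertibility hypothesis of \<open>qform_coercive\<close>: off the spectrum
  det (A - k I) is nonzero.\<close>

lemma left_inverse_of_not_eigenvalue:
  fixes A :: "complex mat"
  assumes A: "A \<in> carrier_mat n n" and "\<not> eigenvalue A k"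
  shows "\<exists>G. \<forall>u. \<forall>i<n. mat_app n G (mat_app n (\<lambda>i j. A $$ (i, j) - (if i = j then k else 0)) u) i = u i"
proof -
  let ?B = "char_matrix A k"
  have B: "?B \<in> carrier_mat n n" using A by simp
  have "det ?B \<noteq> 0" using assms eigenvalue_det by blast
  from det_non_zero_imp_unit[OF B this, unfolded Units_def, of "()"]
  obtain G where G: "G \<in> carrier_mat n n" "G * ?B = 1\<^sub>m n"
    by (auto simp: ring_mat_def)
  have "mat_app n (\<lambda>i j. G $$ (i, j)) (mat_app n (\<lambda>i j. A $$ (i, j) - (if i = j then k else 0)) u) i = u i"
    if i: "i < n" for u i
  proof -
    have B_entry: "?B $$ (j, l) = A $$ (j, l) - (if j = l then k else 0)" if "j < n" "l < n" for j l
      using that A by (auto simp: char_matrix_def)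
    have Bv: "(?B *\<^sub>v vec n u) $ j = mat_app n (\<lambda>i j. A $$ (i, j) - (if i = j then k else 0)) u j"
      if j: "j < n" for j
      unfolding mult_mat_vec_eq_mat_app[OF B vec_carrier j] mat_app_def
      by (intro sum.cong refl) (use j in \<open>auto simp: B_entry\<close>)
    have "u i = (1\<^sub>m n *\<^sub>v vec n u) $ i" using i by simp
    also have "\<dots> = (G *\<^sub>v (?B *\<^sub>v vec n u)) $ i"
      using G B by (metis assoc_mult_mat_vec vec_carrier)
    also have "\<dots> = mat_app n (\<lambda>i j. G $$ (i, j)) (($) (?B *\<^sub>v vec n u)) i"
      by (rule mult_mat_vec_eq_mat_app[OF G(1) _ i]) (use B in auto)
    also have "\<dots> = mat_app n (\<lambda>i j. G $$ (i, j)) (mat_app n (\<lambda>i j. A $$ (i, j) - (if i = j then k else 0)) u) i"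
      unfolding mat_app_def[of n "\<lambda>i j. G $$ (i, j)"]
      by (intro sum.cong refl) (simp add: Bv del: index_mult_mat_vec)
    finally show ?thesis by simp
  qed
  then show ?thesis by blast
qed

text \<open>Here \<open>\<mu>\<close> is the infimum of the Rayleigh quotient. The form of M* M -
  \<open>\<mu>\<close> is nonnegative; if \<open>\<mu>\<close> were not an eigenvalue, this matrix
  would be invertible, so by \<open>qform_coercive\<close> the quotient would stay above
  \<open>\<mu> + c\<close> for some c > 0, contradicting the infimum.\<close>

lemma gram_rayleigh_eigenvalue:
  fixes M :: "complex mat"
  assumes M: "M \<in> carrier_mat n n" and n: "n > 0"
  shows "\<exists>\<mu>. eigenvalue (mat_adjoint M * M) (of_real \<mu>) \<and>
           (\<forall>u. \<mu> * sqnorm n u \<le> sqnorm n (mat_app n (\<lambda>i j. M $$ (i, j)) u))"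
proof -
  let ?A = "mat_adjoint M * M" and ?m = "\<lambda>i j. M $$ (i, j)"
  have A: "?A \<in> carrier_mat n n" by (rule gram_carrier[OF M])
  define R where "R = {sqnorm n (mat_app n ?m u) | u. sqnorm n u = 1}"
  define \<mu> where "\<mu> = Inf R"
  have bdd: "bdd_below R" by (rule bdd_belowI[of _ 0]) (auto simp: R_def)
  have "sqnorm n (\<lambda>i. if i = 0 then 1 else 0) = (\<Sum>i<n. if i = 0 then 1 else 0)"
    unfolding sqnorm_def by (intro sum.cong) auto
  also have "\<dots> = 1" using n by simp
  finally have "R \<noteq> {}" unfolding R_def by blast
  have low: "\<mu> * sqnorm n u \<le> sqnorm n (mat_app n ?m u)" for u
  proof (cases "sqnorm n u = 0")
    case False
    then have pos: "sqnorm n u > 0" using sqnorm_nonneg[of n u] by linarith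
    define c :: complex where "c = of_real (1 / sqrt (sqnorm n u))"
    have c: "(cmod c)\<^sup>2 = 1 / sqnorm n u" using pos by (simp add: c_def power_divide norm_divide)
    have app_scale: "mat_app n ?m (\<lambda>i. c * u i) = (\<lambda>i. c * mat_app n ?m u i)"
      by (rule ext) (simp add: mat_app_def sum_distrib_left mult.left_commute)
    have "sqnorm n (\<lambda>i. c * u i) = 1" using pos by (simp add: sqnorm_scale c)
    then have "sqnorm n (mat_app n ?m (\<lambda>i. c * u i)) \<in> R" unfolding R_def by blast
    then have "\<mu> \<le> sqnorm n (mat_app n ?m (\<lambda>i. c * u i))"
      unfolding \<mu>_def by (intro cInf_lower bdd)
    then show ?thesis using pos by (simp add: app_scale sqnorm_scale c field_simps)
  qed simp
  have "eigenvalue ?A (of_real \<mu>)"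
  proof (rule ccontr)
    assume not_ev: "\<not> ?thesis"
    define B where "B = (\<lambda>i j. ?A $$ (i, j) - (if i = j then complex_of_real \<mu> else 0))"
    obtain G where G: "\<And>u i. i < n \<Longrightarrow> mat_app n G (mat_app n B u) i = u i"
      using left_inverse_of_not_eigenvalue[OF A not_ev] unfolding B_def by blast
    have qB: "qform n B u = sqnorm n (mat_app n ?m u) - \<mu> * sqnorm n u" for u
    proof -
      have "mat_app n B u i = mat_app n (\<lambda>i j. ?A $$ (i, j)) u i - of_real \<mu> * u i" if "i < n" for i
      proof -
        have "(\<Sum>j<n. (if i = j then complex_of_real \<mu> else 0) * u j) = (\<Sum>j<n. if i = j then of_real \<mu> * u j else 0)"
          by (intro sum.cong) auto
        then show ?thesis using that
          by (simp add: mat_app_def B_def left_diff_distrib sum_subtractf del: index_mult_mat)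
      qed
      then have "(\<Sum>i<n. mat_app n B u i * cnj (u i))
          = (\<Sum>i<n. mat_app n (\<lambda>i j. ?A $$ (i, j)) u i * cnj (u i)) - of_real \<mu> * (\<Sum>i<n. u i * cnj (u i))"
        by (simp add: left_diff_distrib sum_subtractf sum_distrib_left mult.assoc)
      then show ?thesis
        unfolding qform_def gram_form[OF M] of_real_sqnorm[symmetric] by simp
    qed
    have "\<exists>c>0. \<forall>u. c * sqnorm n u \<le> qform n B u"
    proof (rule qform_coercive[OF _ _ G])
      fix i j assume "i < n" "j < n"
      then show "B j i = cnj (B i j)"
        by (auto simp: B_def gram_entry[OF M] mult.commute simp del: index_mult_mat)
    qed (simp add: qB low)
    then obtain c where c: "c > 0" "\<And>u. c * sqnorm n u \<le> sqnorm n (mat_app n ?m u) - \<mu> * sqnorm n u"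
      unfolding qB by blast
    have "\<mu> + c \<le> \<mu>"
      unfolding \<mu>_def
    proof (rule cInf_greatest[OF \<open>R \<noteq> {}\<close>])
      fix x assume "x \<in> R"
      then obtain u where "x = sqnorm n (mat_app n ?m u)" "sqnorm n u = 1" unfolding R_def by blast
      then show "Inf R + c \<le> x" using c(2)[of u] by (simp add: \<mu>_def)
    qed
    with c(1) show False by simp
  qed
  with low show ?thesis by blast
qed

text \<open>The second part turns every test vector into an upper bound. The first, that the bound
  is attained, serves measurability.\<close>

lemma smallest_eigenvalue_gram:
  fixes M :: "complex mat"
  assumes M: "M \<in> carrier_mat n n" and n: "n > 0"
  shows "\<exists>u. sqnorm n u > 0 \<and>
      sqnorm n (mat_app n (\<lambda>i j. M $$ (i, j)) u) = smallest_eigenvalue (mat_adjoint M * M) * sqnorm n u"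
    and "smallest_eigenvalue (mat_adjoint M * M) * sqnorm n u \<le> sqnorm n (mat_app n (\<lambda>i j. M $$ (i, j)) u)"
proof -
  let ?A = "mat_adjoint M * M"
  have A: "?A \<in> carrier_mat n n" by (rule gram_carrier[OF M])
  obtain \<mu> where \<mu>: "eigenvalue ?A (of_real \<mu>)"
      "\<And>u. \<mu> * sqnorm n u \<le> sqnorm n (mat_app n (\<lambda>i j. M $$ (i, j)) u)"
    using gram_rayleigh_eigenvalue[OF M n] by blast
  \<comment> \<open>\<open>Min\<close> is meaningful only on a finite nonempty set: finiteness comes
    from the roots of the characteristic polynomial, nonemptiness from \<open>\<mu>\<close>.\<close>
  have "char_poly ?A \<noteq> 0" using degree_monic_char_poly[OF A] by auto
  then have fin: "finite {k. eigenvalue ?A k}"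
    unfolding eigenvalue_root_char_poly[OF A] by (rule poly_roots_finite)
  then have "smallest_eigenvalue ?A \<in> Re ` {k. eigenvalue ?A k}"
    unfolding smallest_eigenvalue_def using \<mu>(1) by (intro Min_in) auto
  then obtain k where "eigenvalue ?A k" "smallest_eigenvalue ?A = Re k" by auto
  then show "\<exists>u. sqnorm n u > 0 \<and>
      sqnorm n (mat_app n (\<lambda>i j. M $$ (i, j)) u) = smallest_eigenvalue ?A * sqnorm n u"
    using gram_eigenvalue[OF M] by metis
  have "smallest_eigenvalue ?A \<le> \<mu>"
    unfolding smallest_eigenvalue_def using fin \<mu>(1)
    by (intro Min_le finite_imageI) (auto intro!: image_eqI[of _ Re "of_real \<mu>"])
  then show "smallest_eigenvalue ?A * sqnorm n u \<le> sqnorm n (mat_app n (\<lambda>i j. M $$ (i, j)) u)"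
    using \<mu>(2)[of u] mult_right_mono[OF _ sqnorm_nonneg[of n u]] by (meson order_trans)
qed

subsection \<open>The smallest eigenvalue of a Vandermonde Gram matrix\<close>

lemma lambda1_mult_sqnorm_le:
  assumes "N > 0"
  shows "lambda1 N \<theta> * sqnorm N u \<le> sqnorm N (mat_app N (\<lambda>j q. cis (2 * pi * \<theta> q) ^ j / of_real (sqrt N)) u)"
    and "lambda1 N \<theta> < c \<longleftrightarrow>
      (\<exists>u. sqnorm N (mat_app N (\<lambda>j q. cis (2 * pi * \<theta> q) ^ j / of_real (sqrt N)) u) < c * sqnorm N u)"
proof -
  let ?V = "vandermonde N \<theta>" and ?v = "\<lambda>j q. cis (2 * pi * \<theta> q) ^ j / complex_of_real (sqrt N)"
  have V: "?V \<in> carrier_mat N N" by (simp add: vandermonde_def)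
  have "exp (2 * of_real pi * \<i> * of_nat j * of_real t) = cis (2 * pi * t) ^ j" for j t
    unfolding cis_conv_exp exp_of_nat_mult[symmetric] by (simp add: mult_ac)
  then have "mat_app N (\<lambda>j q. ?V $$ (j, q)) u j = mat_app N ?v u j" if "j < N" for u j
    using that unfolding mat_app_def vandermonde_def by (intro sum.cong) auto
  then have eq: "sqnorm N (mat_app N (\<lambda>j q. ?V $$ (j, q)) u) = sqnorm N (mat_app N ?v u)" for u
    by (simp add: sqnorm_def)
  note gram = smallest_eigenvalue_gram[OF V assms, folded lambda1_def, unfolded eq]
  show "lambda1 N \<theta> * sqnorm N u \<le> sqnorm N (mat_app N ?v u)" by (rule gram(2))
  show "lambda1 N \<theta> < c \<longleftrightarrow> (\<exists>u. sqnorm N (mat_app N ?v u) < c * sqnorm N u)"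
  proof
    assume "lambda1 N \<theta> < c"
    with gram(1) show "\<exists>u. sqnorm N (mat_app N ?v u) < c * sqnorm N u"
      by (metis mult_strict_right_mono)
  next
    assume "\<exists>u. sqnorm N (mat_app N ?v u) < c * sqnorm N u"
    then obtain u where "lambda1 N \<theta> * sqnorm N u < c * sqnorm N u"
      using gram(2) by (meson order_le_less_trans)
    then show "lambda1 N \<theta> < c"
      by (meson mult_right_mono not_less sqnorm_nonneg)
  qed
qed

text \<open>The strict inequality in \<open>lambda1_mult_sqnorm_le\<close> is an open condition on
  u, so a witness can be taken from a countable dense set. The sublevel set becomes a countable
  union of sets that are measurable because u is fixed in each.\<close>

lemma borel_measurable_lambda1:
  assumes "N > 0"
  shows "lambda1 N \<in> borel_measurable (phase_space N)"
proof (rule borel_measurableI_less)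
  fix c :: real
  define F where "F = (\<lambda>\<theta> u. sqnorm N (mat_app N (\<lambda>j q. cis (2 * pi * \<theta> q) ^ j / of_real (sqrt N)) u) - c * sqnorm N u)"
  obtain D :: "(nat \<Rightarrow> complex) set" where D: "countable D" "\<And>X. open X \<Longrightarrow> X \<noteq> {} \<Longrightarrow> \<exists>d\<in>D. d \<in> X"
    using countable_dense_exists[where ?'a = "nat \<Rightarrow> complex"] by auto
  have "(\<exists>u. F \<theta> u < 0) \<longleftrightarrow> (\<exists>u\<in>D. F \<theta> u < 0)" for \<theta>
  proof -
    have comp: "continuous_on UNIV (\<lambda>u::nat \<Rightarrow> complex. u i)" for i
      by (rule continuous_on_product_coordinates)
    have "open {u. F \<theta> u < 0}"
      unfolding F_def sqnorm_def mat_app_def by (intro open_Collect_less continuous_intros comp)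
    then show ?thesis using D(2)[of "{u. F \<theta> u < 0}"] by blast
  qed
  then have "{\<theta> \<in> space (phase_space N). lambda1 N \<theta> < c}
      = (\<Union>u\<in>D. {\<theta> \<in> space (phase_space N). F \<theta> u < 0})"
    unfolding lambda1_mult_sqnorm_le(2)[OF assms] F_def by auto
  also have "\<dots> \<in> sets (phase_space N)"
  proof (rule sets.countable_UN''[OF D(1)])
    fix u assume "u \<in> D"
    have [measurable]: "(\<lambda>\<theta>. \<theta> q) \<in> borel_measurable (phase_space N)" if "q < N" for q
      using that measurable_component_singleton[of q "{..<N}" "\<lambda>_. uniform_measure lborel {0..1::real}"]
      by (simp add: phase_space_def cong: measurable_cong_sets)
    have "(\<lambda>\<theta>. F \<theta> u) \<in> borel_measurable (phase_space N)"
      unfolding F_def sqnorm_def mat_app_def cis_conv_exp by measurable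
    then show "{\<theta> \<in> space (phase_space N). F \<theta> u < 0} \<in> sets (phase_space N)" by measurable
  qed
  finally show "{\<theta> \<in> space (phase_space N). lambda1 N \<theta> < c} \<in> sets (phase_space N)" .
qed

text \<open>Interpolating w^j at n > j distinct nodes reproduces it exactly; dividing by the nodal
  polynomial P gives the formula. The product over r is P'(z_q).\<close>

lemma lagrange_monomial:
  fixes z :: "nat \<Rightarrow> 'a :: field"
  assumes inj: "inj_on z {..<n}" and j: "j < n" and w: "\<And>q. q < n \<Longrightarrow> w \<noteq> z q"
  shows "(\<Sum>q<n. z q ^ j / ((\<Prod>r\<in>{..<n} - {q}. z q - z r) * (w - z q))) = w ^ j / (\<Prod>q<n. w - z q)"
proof -
  define d where "d q = (\<Prod>r\<in>{..<n} - {q}. z q - z r)" for q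
  define L where "L q = (\<Prod>r\<in>{..<n} - {q}. [:- z r, 1:])" for q
  define p where "p = (\<Sum>q<n. Polynomial.smult (z q ^ j / d q) (L q))"
  have d: "d q \<noteq> 0" if "q < n" for q
    using inj that by (auto simp: d_def prod_zero_iff inj_on_def)
  have L: "poly (L q) x = (\<Prod>r\<in>{..<n} - {q}. x - z r)" for q x
    by (simp add: L_def poly_prod)
  have "degree (L q) \<le> n - 1" if "q < n" for q
    using degree_prod_sum_le[of "{..<n} - {q}" "\<lambda>r. [:- z r, 1:]"] that by (simp add: L_def)
  then have "degree p \<le> n - 1"
    unfolding p_def by (intro degree_sum_le) (auto intro: order_trans[OF degree_smult_le])
  have "poly p (z q) = z q ^ j" if q: "q < n" for q
  proof -
    have "poly p (z q) = (\<Sum>k<n. if k = q then z q ^ j else 0)"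
      unfolding p_def poly_sum
    proof (intro sum.cong refl)
      fix k assume k: "k \<in> {..<n}"
      show "poly (Polynomial.smult (z k ^ j / d k) (L k)) (z q) = (if k = q then z q ^ j else 0)"
      proof (cases "k = q")
        case True
        then show ?thesis using d[OF q] by (simp add: L d_def)
      next
        case False
        then have "poly (L k) (z q) = 0" unfolding L using q by (intro prod_zero) auto
        then show ?thesis using False by simp
      qed
    qed
    then show ?thesis using q by simp
  qed
  then have "p = Polynomial.monom 1 j"
    using j inj \<open>degree p \<le> n - 1\<close>
    by (intro poly_eqI_degree[of "z ` {..<n}"]) (auto simp: poly_monom card_image degree_monom_eq)
  then have "w ^ j = poly p w" by (simp add: poly_monom)
  also have "\<dots> = (\<Sum>q<n. z q ^ j / (d q * (w - z q)) * (\<Prod>r<n. w - z r))"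
    unfolding p_def poly_sum
  proof (intro sum.cong refl)
    fix q assume q: "q \<in> {..<n}"
    have "(\<Prod>r<n. w - z r) = (w - z q) * poly (L q) w"
      unfolding L using q by (subst prod.remove[of _ q]) auto
    then show "poly (Polynomial.smult (z q ^ j / d q) (L q)) w = z q ^ j / (d q * (w - z q)) * (\<Prod>r<n. w - z r)"
      using w[of q] q by simp
  qed
  also have "\<dots> = (\<Sum>q<n. z q ^ j / (d q * (w - z q))) * (\<Prod>r<n. w - z r)"
    by (simp add: sum_distrib_right)
  finally show ?thesis using w by (simp add: d_def field_simps)
qed

lemma lambda1_le_ratio:
  fixes \<theta> :: "nat \<Rightarrow> real" and w0 w1 :: complex
  defines "z \<equiv> \<lambda>q. cis (2 * pi * \<theta> q)"
  assumes N: "N > 0" and norm: "cmod w0 = 1" "cmod w1 = 1"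
    and w0: "\<And>q. q < N \<Longrightarrow> w0 \<noteq> z q" and w1: "\<And>q. q < N \<Longrightarrow> w1 \<noteq> z q"
  shows "lambda1 N \<theta> \<le> 4 * (\<Prod>q<N. cmod (w0 - z q))\<^sup>2 / (\<Prod>q<N. cmod (w1 - z q))\<^sup>2
                       * (\<Sum>q<N. 1 / (cmod (w0 - z q))\<^sup>2)"
    (is "_ \<le> 4 * ?P0\<^sup>2 / ?P1\<^sup>2 * ?B")
proof (cases "inj_on z {..<N}")
  case False
  then obtain i k where ik: "i < N" "k < N" "i \<noteq> k" "z i = z k" by (auto simp: inj_on_def)
  \<comment> \<open>Two equal phases give two equal columns, so the difference of the two unit
    vectors lies in the kernel and \<open>lambda1\<close> is at most 0.\<close>
  define u :: "nat \<Rightarrow> complex" where "u = (\<lambda>q. (if q = i then 1 else 0) - (if q = k then 1 else 0))"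
  have "mat_app N (\<lambda>j q. z q ^ j / of_real (sqrt N)) u j = z i ^ j / of_real (sqrt N) - z k ^ j / of_real (sqrt N)" for j
  proof -
    define f where "f q = z q ^ j / of_real (sqrt N)" for q
    have "f q * u q = (if q = i then f i else 0) - (if q = k then f k else 0)" for q
      by (auto simp: u_def)
    then show ?thesis
      using ik(1,2) by (simp add: mat_app_def sum_subtractf flip: f_def)
  qed
  then have "sqnorm N (mat_app N (\<lambda>j q. z q ^ j / of_real (sqrt N)) u) = 0"
    using ik by (simp add: sqnorm_eq_0_iff)
  then have "lambda1 N \<theta> * sqnorm N u \<le> 0"
    using lambda1_mult_sqnorm_le(1)[OF N, of \<theta> u] by (simp add: z_def)
  moreover have "sqnorm N u > 0" using ik by (intro sqnorm_pos[of i]) (auto simp: u_def)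
  ultimately have "lambda1 N \<theta> \<le> 0" by (simp add: mult_le_0_iff)
  also have "0 \<le> 4 * ?P0\<^sup>2 / ?P1\<^sup>2 * ?B"
    by (intro mult_nonneg_nonneg divide_nonneg_nonneg sum_nonneg) auto
  finally show ?thesis .
next
  case inj: True
  define d where "d q = (\<Prod>r\<in>{..<N} - {q}. z q - z r)" for q
  define u where "u = (\<lambda>q. 1 / (d q * (w1 - z q)))"
  have P0: "?P0 > 0" and P1: "?P1 > 0" using w0 w1 by (auto intro!: prod_pos)
  have B: "?B > 0" using N w0 by (intro sum_pos) auto
  have "mat_app N (\<lambda>j q. z q ^ j / of_real (sqrt N)) u j = w1 ^ j / (\<Prod>q<N. w1 - z q) / of_real (sqrt N)"
    if "j < N" for j
  proof -
    have "mat_app N (\<lambda>j q. z q ^ j / of_real (sqrt N)) u j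
        = (\<Sum>q<N. z q ^ j / (d q * (w1 - z q))) / of_real (sqrt N)"
      unfolding mat_app_def u_def sum_divide_distrib by (intro sum.cong refl) (simp add: divide_simps)
    then show ?thesis
      using lagrange_monomial[OF inj that w1, folded d_def] by simp
  qed
  then have "sqnorm N (mat_app N (\<lambda>j q. z q ^ j / of_real (sqrt N)) u) = (\<Sum>j<N. (1 / ?P1 / sqrt N)\<^sup>2)"
    unfolding sqnorm_def
    by (intro sum.cong refl) (simp add: norm_divide norm_mult norm_power norm prod_norm)
  \<comment> \<open>Because |w1| = 1, all N rows have the same modulus, and the normalisation 1 /
    sqrt N cancels their number.\<close>
  also have "\<dots> = 1 / ?P1\<^sup>2" using N by (simp add: power_divide power_mult_distrib)
  finally have V: "lambda1 N \<theta> * sqnorm N u \<le> 1 / ?P1\<^sup>2"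
    using lambda1_mult_sqnorm_le(1)[OF N, of \<theta> u] by (simp add: z_def)
  have "1 / ?P0 = cmod (\<Sum>q<N. 1 / (d q * (w0 - z q)))"
    using lagrange_monomial[OF inj N w0, folded d_def] by (simp add: norm_divide prod_norm)
  also have "\<dots> \<le> (\<Sum>q<N. 1 / cmod (d q) * (1 / cmod (w0 - z q)))"
    by (rule order_trans[OF norm_sum]) (simp add: norm_divide norm_mult)
  finally have "(1 / ?P0)\<^sup>2 \<le> (\<Sum>q<N. 1 / cmod (d q) * (1 / cmod (w0 - z q)))\<^sup>2"
    using P0 by (intro power_mono) auto
  also have "\<dots> \<le> (\<Sum>q<N. (1 / cmod (d q))\<^sup>2) * (\<Sum>q<N. (1 / cmod (w0 - z q))\<^sup>2)"
    by (rule Cauchy_Schwarz_ineq_sum)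
  also have "\<dots> = (\<Sum>q<N. (1 / cmod (d q))\<^sup>2) * ?B" by (simp add: power_divide)
  also have "\<dots> \<le> 4 * sqnorm N u * ?B"
    unfolding sqnorm_def sum_distrib_left
  proof (intro mult_right_mono sum_mono)
    fix q assume "q \<in> {..<N}"
    \<comment> \<open>Origin of the factor 4: two points of the unit circle are at most 2
      apart.\<close>
    have "(cmod (w1 - z q))\<^sup>2 \<le> 2\<^sup>2"
      using norm_triangle_ineq4[of w1 "z q"] by (intro power_mono) (auto simp: norm z_def)
    moreover have "cmod (w1 - z q) > 0" using w1 \<open>q \<in> _\<close> by auto
    ultimately have "1 \<le> 4 / (cmod (w1 - z q))\<^sup>2" by simp
    then have "(1 / cmod (d q))\<^sup>2 * 1 \<le> (1 / cmod (d q))\<^sup>2 * (4 / (cmod (w1 - z q))\<^sup>2)"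
      by (intro mult_left_mono) auto
    then show "(1 / cmod (d q))\<^sup>2 \<le> 4 * (cmod (u q))\<^sup>2"
      by (simp add: u_def norm_divide norm_mult power_divide power_mult_distrib)
  qed (use B in auto)
  finally have "(1 / ?P0)\<^sup>2 * ?P0\<^sup>2 \<le> 4 * sqnorm N u * ?B * ?P0\<^sup>2"
    by (intro mult_right_mono) auto
  moreover have "(1 / p)\<^sup>2 * p\<^sup>2 = 1" if "p > 0" for p :: real
    using that by (simp add: power_divide)
  ultimately have S: "1 \<le> 4 * ?P0\<^sup>2 * ?B * sqnorm N u"
    using P0 by (simp only: mult_ac)
  show ?thesis
  \<comment> \<open>The lower bound on \<open>sqnorm N u\<close> may be multiplied by
    \<open>lambda1\<close> only when the latter is positive.\<close>
  proof (cases "lambda1 N \<theta> \<le> 0")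
    case True
    also have "0 \<le> 4 * ?P0\<^sup>2 / ?P1\<^sup>2 * ?B" using B by (intro mult_nonneg_nonneg) auto
    finally show ?thesis .
  next
    case False
    then have "lambda1 N \<theta> * 1 \<le> lambda1 N \<theta> * (4 * ?P0\<^sup>2 * ?B * sqnorm N u)"
      using S by (intro mult_left_mono) auto
    also have "\<dots> = (4 * ?P0\<^sup>2 * ?B) * (lambda1 N \<theta> * sqnorm N u)" by simp
    also have "\<dots> \<le> (4 * ?P0\<^sup>2 * ?B) * (1 / ?P1\<^sup>2)"
      using V B by (intro mult_left_mono) auto
    finally show ?thesis by simp
  qed
qed

subsection \<open>The distribution of the logarithm of the tangent\<close>

text \<open>Up to pi/3 the derivative cos - 1/2 is nonnegative; beyond it sin x >= sqrt 3 / 2 >= 4/5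
  > pi/4 >= x/2. Slope 1/2 suffices, since pi/2 >= 1 then gives sin (pi s) >= s.\<close>

lemma sin_ge_half:
  fixes x :: real
  assumes "0 \<le> x" "x \<le> pi / 2"
  shows "x / 2 \<le> sin x"
proof -
  have *: "y / 2 \<le> sin y" if y: "0 \<le> y" "y \<le> pi / 3" for y :: real
  proof -
    have "(\<lambda>y. sin y - y / 2) 0 \<le> (\<lambda>y. sin y - y / 2) y"
    proof (rule DERIV_nonneg_imp_nondecreasing[OF y(1)])
      fix t assume t: "0 \<le> t" "t \<le> y"
      have "cos (pi / 3) \<le> cos t" using t y by (intro cos_monotone_0_pi_le) auto
      then have "0 \<le> cos t - 1 / 2" by (simp add: cos_60)
      moreover have "((\<lambda>y. sin y - y / 2) has_real_derivative cos t - 1 / 2) (at t)"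
        by (auto intro!: derivative_eq_intros)
      ultimately show "\<exists>d. ((\<lambda>y. sin y - y / 2) has_real_derivative d) (at t) \<and> 0 \<le> d" by blast
    qed
    then show ?thesis by simp
  qed
  show ?thesis
  proof (cases "x \<le> pi / 3")
    case False
    have "sin (pi / 3) \<le> sin x" using False assms by (intro sin_monotone_2pi_le) auto
    moreover have "(8 / 5 :: real) \<le> sqrt 3" by (rule real_le_rsqrt) (simp add: power2_eq_square)
    moreover have "pi < 3.2" using pi_approx by simp
    ultimately show ?thesis using assms by (simp add: sin_60)
  qed (use * assms in auto)
qed

lemma abs_sin_pi_ge:
  fixes t :: real
  assumes "0 \<le> t" "t \<le> 1"
  shows "min t (1 - t) \<le> \<bar>sin (pi * t)\<bar>"
proof -
  have *: "s \<le> sin (pi * s)" if "0 \<le> s" "s \<le> 1 / 2" for s :: real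
  proof -
    have "s * 2 \<le> s * pi" using that pi_ge_two by (intro mult_left_mono) auto
    then show ?thesis using sin_ge_half[of "pi * s"] that by (simp add: mult.commute)
  qed
  have "sin (pi * (1 - t)) = sin (pi * t)" by (simp add: right_diff_distrib)
  then show ?thesis using *[of t] *[of "1 - t"] assms by (cases "t \<le> 1 / 2") auto
qed

lemma abs_cos_pi_ge:
  fixes t :: real
  assumes "0 \<le> t" "t \<le> 1"
  shows "\<bar>1 / 2 - t\<bar> \<le> \<bar>cos (pi * t)\<bar>"
proof -
  define s where "s = \<bar>1 / 2 - t\<bar>"
  have s: "0 \<le> s" "s \<le> 1 / 2" using assms unfolding s_def by linarith+
  have "cos (pi * t) = sin (pi * (1 / 2 - t))" by (simp add: sin_cos_eq right_diff_distrib)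
  then have "\<bar>cos (pi * t)\<bar> = \<bar>sin (pi * s)\<bar>"
    by (auto simp: s_def abs_if right_diff_distrib sin_diff)
  moreover have "min s (1 - s) = s" using s by auto
  ultimately show ?thesis using abs_sin_pi_ge[of s] s by (simp add: s_def[symmetric])
qed

lemma integrable_abs_powr_minus_half:
  "integrable lborel (\<lambda>x::real. indicator {-1..1} x * \<bar>x\<bar> powr (-1/2))"
proof -
  define g where "g = (\<lambda>x::real. indicator {0..1} x * x powr (-1/2))"
  have "(\<lambda>x::real. x powr (-1/2)) absolutely_integrable_on {0..1}"
    by (intro nonnegative_absolutely_integrable_1 integrable_on_powr_from_0) auto
  then have "integrable lebesgue g" by (simp add: set_integrable_def g_def)
  moreover have "g \<in> borel_measurable lborel" unfolding g_def by measurable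
  ultimately have g: "integrable lborel g" using integrable_completion by blast
  then have g': "integrable lborel (\<lambda>x. g (0 + (-1) * x))"
    by (rule lborel_integrable_real_affine) simp
  have "norm (indicator {-1..1} x * \<bar>x\<bar> powr (-1/2)) \<le> norm (g x + g (0 + (-1) * x))" for x
    by (cases "x \<ge> 0") (simp_all add: g_def indicator_def)
  then show ?thesis
    by (intro Bochner_Integration.integrable_bound[OF Bochner_Integration.integrable_add[OF g g']])
       simp_all
qed

definition log_tan :: "real \<Rightarrow> real" where
  "log_tan t = ln \<bar>tan (pi * t)\<bar>"

lemma borel_measurable_log_tan [measurable]: "log_tan \<in> borel_measurable borel"
  unfolding log_tan_def tan_def by measurable

text \<open>Holds at the poles as well, thanks to the conventions \<open>inverse 0 = 0\<close> and
  \<open>ln 0 = 0\<close>.\<close>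

lemma log_tan_reflect: "log_tan (1 / 2 - t) = - log_tan t"
proof -
  have "tan (pi * (1 / 2 - t)) = inverse (tan (pi * t))"
    using tan_cot[of "pi * t"] by (simp add: right_diff_distrib)
  then show ?thesis
    by (cases "tan (pi * t) = 0") (auto simp: log_tan_def ln_inverse)
qed

lemma log_tan_periodic: "log_tan (t + 1) = log_tan t"
  by (simp add: log_tan_def distrib_left)

text \<open>With exponent 1/2 the singularities at 0, 1/2 and 1 are integrable; exponent 1 would be
  too large. Both logarithms are nonpositive, so their difference is bounded by the larger modulus,
  and a sum of powers rather than a product results.\<close>

lemma exp_half_abs_log_tan_le:
  assumes t: "0 \<le> t" "t \<le> 1" "t \<notin> {0, 1 / 2, 1}"
  shows "exp (\<bar>log_tan t\<bar> / 2)
    \<le> t powr (-1/2) + (1 - t) powr (-1/2) + \<bar>1 / 2 - t\<bar> powr (-1/2)"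
proof -
  define s c where "s = \<bar>sin (pi * t)\<bar>" and "c = \<bar>cos (pi * t)\<bar>"
  have s: "min t (1 - t) \<le> s" "0 < s" "s \<le> 1" and c: "\<bar>1 / 2 - t\<bar> \<le> c" "0 < c" "c \<le> 1"
    using abs_sin_pi_ge[of t] abs_cos_pi_ge[of t] t by (auto simp: s_def c_def)
  have "log_tan t = ln s - ln c"
    using s(2) c(2) by (simp add: log_tan_def tan_def s_def c_def abs_divide ln_div)
  moreover have "ln s \<le> 0" "ln c \<le> 0" using s c by auto
  ultimately have "\<bar>log_tan t\<bar> \<le> max (- ln s) (- ln c)" by auto
  then have "exp (\<bar>log_tan t\<bar> / 2) \<le> exp (max (- ln s) (- ln c) / 2)" by simp
  also have "\<dots> \<le> exp (- ln s / 2) + exp (- ln c / 2)" by (auto simp: max_def)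
  also have "\<dots> = s powr (-1/2) + c powr (-1/2)" using s c by (simp add: powr_def)
  also have "s powr (-1/2) \<le> (min t (1 - t)) powr (-1/2)"
    using s t by (intro powr_mono2') auto
  also have "\<dots> \<le> t powr (-1/2) + (1 - t) powr (-1/2)" by (auto simp: min_def)
  also have "c powr (-1/2) \<le> \<bar>1 / 2 - t\<bar> powr (-1/2)" using c t by (intro powr_mono2') auto
  finally show ?thesis by simp
qed

section \<open>Moments and tails of \<open>log_tan\<close> under the uniform law\<close>

abbreviation "unif \<equiv> uniform_measure lborel {0..1::real}"

lemma prob_space_unif: "prob_space unif"
  by (rule prob_space_uniform_measure) auto

lemma unif_eq_density: "unif = density lborel (\<lambda>x. ennreal (indicator {0..1} x))"
  by (simp add: uniform_measure_def ennreal_indicator divide_ennreal_def)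

lemma integrable_unif_iff:
  fixes f :: "real \<Rightarrow> real"
  assumes "f \<in> borel_measurable borel"
  shows "integrable unif f \<longleftrightarrow> integrable lborel (\<lambda>x. indicator {0..1} x * f x)"
  unfolding unif_eq_density using assms by (subst integrable_density) auto

lemma integral_unif:
  fixes f :: "real \<Rightarrow> real"
  assumes "f \<in> borel_measurable borel"
  shows "(\<integral>x. f x \<partial>unif) = (\<integral>x. indicator {0..1} x * f x \<partial>lborel)"
  unfolding unif_eq_density using assms by (subst integral_density) auto

lemma AE_unif_regular: "AE t in unif. 0 \<le> t \<and> t \<le> 1 \<and> t \<notin> {0, 1 / 2, 1}"
proof -
  have "AE t in lborel. t \<notin> {0, 1 / 2, 1 :: real}"
    by (intro AE_not_in finite_imp_null_set_lborel) auto
  then show ?thesis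
    unfolding unif_eq_density
    by (subst AE_density, simp) (rule eventually_mono, assumption, auto split: split_indicator)
qed

lemma integrable_exp_half_abs_log_tan: "integrable unif (\<lambda>t. exp (\<bar>log_tan t\<bar> / 2))"
proof -
  define h where "h = (\<lambda>x::real. indicator {-1..1} x * \<bar>x\<bar> powr (-1/2))"
  have h: "integrable lborel h" unfolding h_def by (rule integrable_abs_powr_minus_half)
  \<comment> \<open>One copy of \<open>h\<close> for each singularity 0, 1 and 1/2; the support
    [-1, 1] covers the image of [0, 1] under all three affine maps.\<close>
  have "integrable lborel (\<lambda>x. h (0 + 1 * x) + h (1 + (-1) * x) + h (1/2 + (-1) * x))"
    by (intro Bochner_Integration.integrable_add lborel_integrable_real_affine[OF h]) auto
  then have "integrable lborel (\<lambda>x. indicator {0..1} x * exp (\<bar>log_tan x\<bar> / 2))"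
  proof (rule Bochner_Integration.integrable_bound)
    have "AE t in lborel. t \<notin> {0, 1 / 2, 1 :: real}"
      by (intro AE_not_in finite_imp_null_set_lborel) auto
    then show "AE x in lborel. norm (indicator {0..1} x * exp (\<bar>log_tan x\<bar> / 2))
        \<le> norm (h (0 + 1 * x) + h (1 + (-1) * x) + h (1/2 + (-1) * x))"
    proof eventually_elim
      case (elim x)
      show ?case
      proof (cases "0 \<le> x \<and> x \<le> 1")
        case True
        then have "exp (\<bar>log_tan x\<bar> / 2) \<le> h (0 + 1 * x) + h (1 + (-1) * x) + h (1/2 + (-1) * x)"
          using exp_half_abs_log_tan_le[of x] elim by (auto simp: h_def)
        then show ?thesis using True by (simp add: indicator_def)
      qed auto
    qed
  qed measurable
  then show ?thesis by (subst integrable_unif_iff) auto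
qed

lemma integrable_log_tan_power2: "integrable unif (\<lambda>t. (log_tan t)\<^sup>2)"
proof (rule Bochner_Integration.integrable_bound)
  show "integrable unif (\<lambda>t. 8 * exp (\<bar>log_tan t\<bar> / 2))"
    by (intro integrable_mult_right integrable_exp_half_abs_log_tan)
  \<comment> \<open>The quadratic Taylor term of exp at |x| / 2 is x^2 / 8.\<close>
  have "x\<^sup>2 \<le> 8 * exp (\<bar>x\<bar> / 2)" for x :: real
    using exp_lower_Taylor_quadratic[of "\<bar>x\<bar> / 2"] by (simp add: power_divide)
  then show "AE t in unif. norm ((log_tan t)\<^sup>2) \<le> norm (8 * exp (\<bar>log_tan t\<bar> / 2))" by simp
qed auto

lemma integrable_log_tan: "integrable unif log_tan"
proof -
  interpret prob_space unif by (rule prob_space_unif)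
  show ?thesis by (rule square_integrable_imp_integrable[OF _ integrable_log_tan_power2]) auto
qed

lemma lborel_integral_antisymmetric:
  fixes f :: "real \<Rightarrow> real"
  assumes antisym: "\<And>x. f (a - x) = - f x"
  shows "(\<integral>x. f x \<partial>lborel) = 0"
proof -
  have "f (a + (-1) * x) = - f x" for x
  proof -
    have *: "a + (-1) * x = a - x" by simp
    show ?thesis unfolding * by (rule antisym)
  qed
  then have "(\<lambda>x. f (a + (-1) * x)) = (\<lambda>x. - f x)" by (rule ext)
  moreover define I where "I = (\<integral>x. f x \<partial>lborel)"
  moreover have "I = \<bar>-1\<bar> *\<^sub>R (\<integral>x. f (a + (-1) * x) \<partial>lborel)"
    unfolding I_def by (rule lborel_integral_real_affine) simp
  ultimately have "I = - I" by simp
  then show ?thesis by (simp add: I_def)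
qed

text \<open>\<open>log_tan\<close> is odd about 1/4 and about 3/4. Neither reflection preserves
  [0, 1], hence the separate treatment of the two halves.\<close>

lemma integral_log_tan: "(\<integral>t. log_tan t \<partial>unif) = 0"
proof -
  define f where "f = (\<lambda>x::real. indicator {0..1/2} x * log_tan x)"
  define g where "g = (\<lambda>x::real. indicator {1/2..1} x * log_tan x)"
  have int: "integrable lborel (\<lambda>x. indicator {0..1} x * log_tan x)"
    using integrable_log_tan by (simp add: integrable_unif_iff)
  have "integrable lborel f" "integrable lborel g"
    by (rule Bochner_Integration.integrable_bound[OF int];
        auto simp: f_def g_def split: split_indicator)+
  moreover have "indicator {0..1} x * log_tan x = f x + g x" for x
  \<comment> \<open>The point 1/2 belongs to both halves; counting it twice is harmless because
    \<open>log_tan\<close> vanishes there by convention.\<close>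
  proof (cases "x = 1 / 2")
    case True
    have "log_tan (1 / 2) = 0" using log_tan_reflect[of 0] by (simp add: log_tan_def[of 0])
    then show ?thesis unfolding True by (simp add: f_def g_def)
  qed (auto simp: f_def g_def split: split_indicator)
  ultimately have "(\<integral>t. log_tan t \<partial>unif) = (\<integral>x. f x \<partial>lborel) + (\<integral>x. g x \<partial>lborel)"
    by (simp add: integral_unif)
  also have "(\<integral>x. f x \<partial>lborel) = 0"
  proof (rule lborel_integral_antisymmetric[of _ "1/2"])
    fix x :: real
    have "indicator {0..1/2} (1/2 - x) = (indicator {0..1/2} x :: real)"
      by (auto simp: indicator_def)
    then show "f (1/2 - x) = - f x" by (simp only: f_def log_tan_reflect mult_minus_right)
  qed
  also have "(\<integral>x. g x \<partial>lborel) = 0"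
  proof (rule lborel_integral_antisymmetric[of _ "3/2"])
    fix x :: real
    have "3/2 - x = 1/2 - x + 1" by simp
    then have "log_tan (3/2 - x) = - log_tan x" by (simp only: log_tan_periodic log_tan_reflect)
    moreover have "indicator {1/2..1} (3/2 - x) = (indicator {1/2..1} x :: real)"
      by (auto simp: indicator_def)
    ultimately show "g (3/2 - x) = - g x" by (simp only: g_def mult_minus_right)
  qed
  finally show ?thesis by simp
qed

lemma log_tan_le:
  assumes "0 < t" "t \<le> 1 / 8"
  shows "log_tan t \<le> - ln (cos (pi/8) / sin (pi/8))"
proof -
  have "0 < tan (pi * t)" using assms by (intro tan_gt_zero) auto
  moreover have "tan (pi * t) \<le> tan (pi / 8)"
  proof (rule tan_mono_le)
    have "0 < pi * t" using assms by simp
    then show "- (pi / 2) < pi * t" using pi_gt_zero by linarith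
  qed (use assms in auto)
  moreover have "- ln (cos (pi/8) / sin (pi/8)) = ln (tan (pi/8))"
    by (simp add: tan_def ln_div sin_gt_zero cos_gt_zero)
  ultimately show ?thesis by (simp add: log_tan_def)
qed

lemma integral_log_tan_power2_ge:
  "(ln (cos (pi/8) / sin (pi/8)))\<^sup>2 / 4 \<le> (\<integral>t. (log_tan t)\<^sup>2 \<partial>unif)"
proof -
  define \<gamma> where "\<gamma> = ln (cos (pi/8) / sin (pi/8))"
  interpret prob_space unif by (rule prob_space_unif)
  \<comment> \<open>Only the part of the favourable set below 1/2 is taken; its mass 1/4 already
    gives the required bound. The endpoints 0 and 1/2 are left out because \<open>log_tan\<close> is
    0 there.\<close>
  define A where "A = {0<..1/8} \<union> {3/8..<1/2::real}"
  have "{0..1} \<inter> {0<..1/8::real} = {0<..1/8}" "{0..1} \<inter> {3/8..<1/2::real} = {3/8..<1/2}"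
    by auto
  then have "measure unif {0<..1/8} = 1/8" "measure unif {3/8..<1/2} = 1/8"
    by (simp_all add: measure_uniform_measure)
  then have "measure unif A = 1 / 4"
    unfolding A_def by (subst finite_measure_Union) auto
  then have "\<gamma>\<^sup>2 / 4 = (\<integral>t. \<gamma>\<^sup>2 * indicator A t \<partial>unif)" by (simp add: A_def)
  also have "\<dots> \<le> (\<integral>t. (log_tan t)\<^sup>2 \<partial>unif)"
  proof (rule integral_mono)
    show "integrable unif (\<lambda>t. (log_tan t)\<^sup>2)" by (rule integrable_log_tan_power2)
    show "integrable unif (\<lambda>t. \<gamma>\<^sup>2 * indicator A t)"
      by (intro integrable_mult_right integrable_const_bound[of _ 1]) (auto simp: A_def indicator_def)
    fix t :: real
    have \<gamma>: "\<gamma> \<ge> 0" unfolding \<gamma>_def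
    proof (rule ln_ge_zero)
      have "sin (pi/8) \<le> cos (pi/8)" unfolding cos_sin_eq by (intro sin_monotone_2pi_le) auto
      then show "1 \<le> cos (pi/8) / sin (pi/8)" by (simp add: sin_gt_zero)
    qed
    have "\<gamma>\<^sup>2 \<le> (log_tan s)\<^sup>2" if "0 < s" "s \<le> 1/8" for s
    proof -
      have "\<gamma>\<^sup>2 \<le> (- log_tan s)\<^sup>2"
        using log_tan_le[OF that] \<gamma> by (intro power_mono) (auto simp: \<gamma>_def)
      then show ?thesis by simp
    qed
    note far = this
    have reflect: "(log_tan (1/2 - t))\<^sup>2 = (log_tan t)\<^sup>2"
      by (simp only: log_tan_reflect power2_minus)
    show "\<gamma>\<^sup>2 * indicator A t \<le> (log_tan t)\<^sup>2"
    proof (cases "t \<in> A")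
      case True
      then consider "0 < t" "t \<le> 1/8" | "0 < 1/2 - t" "1/2 - t \<le> 1/8" by (force simp: A_def)
      then show ?thesis using far[of t] far[of "1/2 - t", unfolded reflect] True by cases auto
    qed simp
  qed
  finally show ?thesis by (simp add: \<gamma>_def)
qed

text \<open>Markov's inequality for exp(|X| / 2); C is the mean of that variable.\<close>

lemma measure_log_tan_tail:
  "\<exists>C. \<forall>s. measure unif {t. s < \<bar>log_tan t\<bar>} \<le> C * exp (- s / 2)"
proof (intro exI allI)
  fix s :: real
  interpret prob_space unif by (rule prob_space_unif)
  have "measure unif {t. s < \<bar>log_tan t\<bar>} \<le> measure unif {t \<in> space unif. exp (s / 2) \<le> exp (\<bar>log_tan t\<bar> / 2)}"
  proof (rule finite_measure_mono)
    show "{t. s < \<bar>log_tan t\<bar>} \<subseteq> {t \<in> space unif. exp (s / 2) \<le> exp (\<bar>log_tan t\<bar> / 2)}"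
      by (simp add: subset_eq)
    have "{t \<in> space unif. exp (s / 2) \<le> exp (\<bar>log_tan t\<bar> / 2)} \<in> sets unif" by measurable
    then show "{t \<in> space unif. exp (s / 2) \<le> exp (\<bar>log_tan t\<bar> / 2)} \<in> events" .
  qed
  also have "\<dots> \<le> (\<integral>t. exp (\<bar>log_tan t\<bar> / 2) \<partial>unif) / exp (s / 2)"
    by (rule integral_Markov_inequality_measure[OF integrable_exp_half_abs_log_tan sets.empty_sets])
       simp_all
  finally show "measure unif {t. s < \<bar>log_tan t\<bar>} \<le> (\<integral>t. exp (\<bar>log_tan t\<bar> / 2) \<partial>unif) * exp (- s / 2)"
    by (simp only: divide_inverse[of _ "exp (s / 2)"] exp_minus[symmetric] minus_divide_left)
qed

subsection \<open>From the logarithmic sum to the smallest eigenvalue\<close>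

lemma norm_one_minus_cis_double: "cmod (1 - cis (2 * y)) = 2 * \<bar>sin y\<bar>"
proof -
  have "1 - cis (2 * y) = - 2 * \<i> * of_real (sin y) * cis y"
    by (simp add: complex_eq_iff cos_double_sin sin_double power2_eq_square)
  then show ?thesis by (simp add: norm_mult)
qed

lemma norm_minus_one_minus_cis_double: "cmod (- 1 - cis (2 * y)) = 2 * \<bar>cos y\<bar>"
proof -
  have "- 1 - cis (2 * y) = - 2 * of_real (cos y) * cis y"
    by (simp add: complex_eq_iff cos_double_cos sin_double power2_eq_square)
  then show ?thesis by (simp add: norm_mult)
qed

lemma exp_log_tan:
  assumes "sin (pi * t) \<noteq> 0" "cos (pi * t) \<noteq> 0"
  shows "exp (log_tan t) = \<bar>sin (pi * t)\<bar> / \<bar>cos (pi * t)\<bar>"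
  using assms by (simp add: log_tan_def tan_def abs_divide)

text \<open>The test points 1 and -1 are at distance 2 |sin| and 2 |cos| from z_q, so their ratio is
  |tan|. Choosing their order by the sign of the sum makes the exponent -2 |S| in both
  cases.\<close>

lemma lambda1_le_exp:
  fixes \<theta> :: "nat \<Rightarrow> real"
  assumes N: "N > 0"
    and reg: "\<And>q. q < N \<Longrightarrow> 0 \<le> \<theta> q \<and> \<theta> q \<le> 1 \<and> \<theta> q \<notin> {0, 1 / 2, 1}"
    and s: "\<And>q. q < N \<Longrightarrow> \<bar>log_tan (\<theta> q)\<bar> \<le> s"
  shows "lambda1 N \<theta> \<le> 2 * real N * exp (2 * s) * exp (- 2 * \<bar>\<Sum>q<N. log_tan (\<theta> q)\<bar>)"
proof -
  define z where "z q = cis (2 * pi * \<theta> q)" for q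
  define S where "S = (\<Sum>q<N. log_tan (\<theta> q))"
  have sc: "sin (pi * \<theta> q) \<noteq> 0" "cos (pi * \<theta> q) \<noteq> 0" if "q < N" for q
    using abs_sin_pi_ge[of "\<theta> q"] abs_cos_pi_ge[of "\<theta> q"] reg[OF that] by auto
  have n1: "cmod (1 - z q) = 2 * \<bar>sin (pi * \<theta> q)\<bar>"
    and n2: "cmod (- 1 - z q) = 2 * \<bar>cos (pi * \<theta> q)\<bar>" for q
    using norm_one_minus_cis_double[of "pi * \<theta> q"] norm_minus_one_minus_cis_double[of "pi * \<theta> q"]
    by (simp_all add: z_def mult.assoc)
  have ne: "1 \<noteq> z q" "- 1 \<noteq> z q" if "q < N" for q
    using n1[of q] n2[of q] sc[OF that] by auto
  have ratio: "(\<Prod>q<N. cmod (1 - z q)) / (\<Prod>q<N. cmod (- 1 - z q)) = exp S"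
    unfolding S_def exp_sum[OF finite_lessThan] prod_dividef[symmetric]
    by (intro prod.cong refl) (simp add: n1 n2 exp_log_tan sc)
  have "1 / (cmod (1 - z q))\<^sup>2 \<le> exp (2 * s) / 2 \<and> 1 / (cmod (- 1 - z q))\<^sup>2 \<le> exp (2 * s) / 2"
    if q: "q < N" for q
  proof -
    define a b where "a = sin (pi * \<theta> q)" and "b = cos (pi * \<theta> q)"
    have ab: "a \<noteq> 0" "b \<noteq> 0" "a\<^sup>2 + b\<^sup>2 = 1" using sc[OF q] by (auto simp: a_def b_def)
    have e: "exp (log_tan (\<theta> q)) = \<bar>a\<bar> / \<bar>b\<bar>" "exp (- log_tan (\<theta> q)) = \<bar>b\<bar> / \<bar>a\<bar>"
      using exp_log_tan[OF sc[OF q]] by (simp_all add: a_def b_def exp_minus)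
    have "0 \<le> s" using s[OF q] by linarith
    then have "1 \<le> exp (2 * s)" by simp
    have "(\<bar>a\<bar> / \<bar>b\<bar>)\<^sup>2 \<le> (exp s)\<^sup>2" "(\<bar>b\<bar> / \<bar>a\<bar>)\<^sup>2 \<le> (exp s)\<^sup>2"
      unfolding e[symmetric] using s[OF q] by (intro power_mono; simp; linarith)+
    then have le: "a\<^sup>2 / b\<^sup>2 \<le> exp (2 * s)" "b\<^sup>2 / a\<^sup>2 \<le> exp (2 * s)"
      by (simp_all add: power_divide exp_double)
    have mean: "(1 + x) / 4 \<le> y / 2" if "x \<le> y" "1 \<le> y" for x y :: real
      using that by (simp add: field_simps)
    \<comment> \<open>Writing 1 as sin^2 + cos^2 expresses the inverse squared distances through
      cot^2 and tan^2, which are at most exp(2 s).\<close>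
    have "1 / (2 * \<bar>a\<bar>)\<^sup>2 = (a\<^sup>2 + b\<^sup>2) / (4 * a\<^sup>2)" "1 / (2 * \<bar>b\<bar>)\<^sup>2 = (a\<^sup>2 + b\<^sup>2) / (4 * b\<^sup>2)"
      unfolding ab(3) by (simp_all add: power_mult_distrib)
    then have eqs: "1 / (2 * \<bar>a\<bar>)\<^sup>2 = (1 + b\<^sup>2 / a\<^sup>2) / 4" "1 / (2 * \<bar>b\<bar>)\<^sup>2 = (1 + a\<^sup>2 / b\<^sup>2) / 4"
      using ab(1,2) by (simp_all add: field_simps)
    then show ?thesis
      unfolding n1 n2 a_def[symmetric] b_def[symmetric] eqs
      using mean[OF le(1)] mean[OF le(2)] \<open>1 \<le> exp (2 * s)\<close> by blast
  qed
  then have sum: "(\<Sum>q<N. 1 / (cmod (w - z q))\<^sup>2) \<le> real N * (exp (2 * s) / 2)" if "w = 1 \<or> w = - 1" for w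
    using that sum_bounded_above[of "{..<N}" "\<lambda>q. 1 / (cmod (w - z q))\<^sup>2" "exp (2 * s) / 2"] by auto
  have "lambda1 N \<theta> \<le> 4 * (exp (- \<bar>S\<bar>))\<^sup>2 * (real N * (exp (2 * s) / 2))"
  proof (cases "S \<le> 0")
    case True
    have "lambda1 N \<theta> \<le> 4 * (\<Prod>q<N. cmod (1 - z q))\<^sup>2 / (\<Prod>q<N. cmod (- 1 - z q))\<^sup>2
                       * (\<Sum>q<N. 1 / (cmod (1 - z q))\<^sup>2)"
      unfolding z_def using ne by (intro lambda1_le_ratio N) (auto simp: z_def)
    also have "\<dots> = 4 * (exp S)\<^sup>2 * (\<Sum>q<N. 1 / (cmod (1 - z q))\<^sup>2)"
      unfolding ratio[symmetric] by (simp add: power_divide)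
    also have "\<dots> \<le> 4 * (exp S)\<^sup>2 * (real N * (exp (2 * s) / 2))"
      by (intro mult_left_mono sum) auto
    finally show ?thesis using True by simp
  next
    case False
    have "lambda1 N \<theta> \<le> 4 * (\<Prod>q<N. cmod (- 1 - z q))\<^sup>2 / (\<Prod>q<N. cmod (1 - z q))\<^sup>2
                       * (\<Sum>q<N. 1 / (cmod (- 1 - z q))\<^sup>2)"
      unfolding z_def using ne by (intro lambda1_le_ratio N) (auto simp: z_def)
    also have "\<dots> = 4 * (exp (- S))\<^sup>2 * (\<Sum>q<N. 1 / (cmod (- 1 - z q))\<^sup>2)"
      unfolding exp_minus ratio[symmetric] by (simp add: power_divide)
    also have "\<dots> \<le> 4 * (exp (- S))\<^sup>2 * (real N * (exp (2 * s) / 2))"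
      by (intro mult_left_mono sum) auto
    finally show ?thesis using False by simp
  qed
  also have "\<dots> = 2 * real N * exp (2 * s) * exp (- 2 * \<bar>S\<bar>)"
  proof -
    have "exp (- 2 * \<bar>S\<bar>) = exp (2 * (- \<bar>S\<bar>))" by simp
    then show ?thesis unfolding exp_double[of "- \<bar>S\<bar>"] by simp
  qed
  finally show ?thesis unfolding S_def .
qed

subsection \<open>Anticoncentration of the sum\<close>

lemma measure_std_normal_le:
  assumes "a \<le> b"
  shows "measure std_normal_distribution {a<..b} \<le> (b - a) / sqrt (2 * pi)"
proof -
  have "emeasure std_normal_distribution {a<..b}
      = (\<integral>\<^sup>+x. ennreal (std_normal_density x) * indicator {a<..b} x \<partial>lborel)"
    by (rule emeasure_density) auto
  also have "\<dots> \<le> (\<integral>\<^sup>+x. ennreal (1 / sqrt (2 * pi)) * indicator {a<..b} x \<partial>lborel)"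
    by (intro nn_integral_mono mult_right_mono ennreal_leI) (auto simp: normal_density_def divide_right_mono)
  also have "\<dots> = ennreal (1 / sqrt (2 * pi)) * ennreal (b - a)"
    using assms by (subst nn_integral_cmult_indicator) auto
  also have "\<dots> = ennreal ((b - a) / sqrt (2 * pi))"
    using assms by (simp add: ennreal_mult[symmetric])
  finally show ?thesis
    unfolding measure_def using assms by (intro enn2real_leI) auto
qed

text \<open>Weak convergence yields convergence of distribution functions only at continuity points
  of the limit.\<close>

lemma isCont_cdf_std_normal: "isCont (cdf std_normal_distribution) x"
proof -
  interpret real_distribution std_normal_distribution by (rule real_dist_normal_dist)
  have "emeasure std_normal_distribution {x} = 0"
    by (subst emeasure_density) auto
  then show ?thesis unfolding isCont_cdf by (simp add: measure_def)
qed

section \<open>Infinite sequences of phases\<close>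

lemma borel_measurable_unif [simp]: "f \<in> borel_measurable unif \<longleftrightarrow> f \<in> borel_measurable borel"
  by (simp cong: measurable_cong_sets)

abbreviation "seq_space \<equiv> PiM (UNIV :: nat set) (\<lambda>_. unif)"

interpretation seq: product_prob_space "\<lambda>_::nat. unif" UNIV
  by (intro product_prob_spaceI prob_space_unif)

lemma measurable_seq_coord [measurable]: "(\<lambda>\<omega>. \<omega> i) \<in> borel_measurable seq_space"
  using measurable_component_singleton[of i UNIV "\<lambda>_. unif"] by (simp cong: measurable_cong_sets)

lemma distr_seq_coord:
  assumes "f \<in> borel_measurable borel"
  shows "distr seq_space borel (\<lambda>\<omega>. f (\<omega> i)) = distr unif borel (f :: real \<Rightarrow> real)"
proof -
  have "distr unif borel f = distr (distr seq_space unif (\<lambda>\<omega>. \<omega> i)) borel f"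
    using seq.PiM_component[of i] by simp
  also have "\<dots> = distr seq_space borel (\<lambda>\<omega>. f (\<omega> i))"
    using assms by (subst distr_distr) (auto simp: o_def measurable_component_singleton)
  finally show ?thesis by simp
qed

lemma indep_log_tan: "seq.P.indep_vars (\<lambda>_. borel) (\<lambda>i \<omega>. log_tan (\<omega> i)) UNIV"
proof (rule seq.P.indep_vars_compose2[where M'="\<lambda>_. unif" and X="\<lambda>i \<omega>. \<omega> i"])
  show "seq.P.indep_vars (\<lambda>_. unif) (\<lambda>i \<omega>. \<omega> i) UNIV"
    \<comment> \<open>The coordinates jointly form the identity map, whose law is the product
      measure itself.\<close>
    by (subst seq.P.indep_vars_iff_distr_eq_PiM')
       (simp_all only: seq.PiM_component[OF UNIV_I] restrict_UNIV distr_id UNIV_not_empty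
          not_False_eq_True measurable_component_singleton[where M="\<lambda>_. unif"])
qed simp

text \<open>After normalisation the sum must fall in an interval of length 2 tau / sigma, where the
  limiting density is at most 1 / sqrt(2 pi).\<close>

lemma log_tan_sum_anticoncentration:
  fixes \<tau> a \<sigma> :: real
  assumes \<sigma>: "0 < \<sigma>" "\<sigma>\<^sup>2 = (\<integral>t. (log_tan t)\<^sup>2 \<partial>unif)" and "0 < \<tau>" and a: "2 * \<tau> / (\<sigma> * sqrt (2 * pi)) < a"
  shows "\<forall>\<^sub>F n in sequentially.
    measure seq_space {\<omega> \<in> space seq_space. \<bar>\<Sum>i<n. log_tan (\<omega> i)\<bar> \<le> \<tau> * sqrt (real n)} < a"
proof -
  define T where "T n \<omega> = (\<Sum>i<n. log_tan (\<omega> i)) / sqrt (real n * \<sigma>\<^sup>2)" for n and \<omega> :: "nat \<Rightarrow> real"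
  have T [measurable]: "T n \<in> borel_measurable seq_space" for n unfolding T_def by measurable
  have integral: "(\<integral>\<omega>. f (log_tan (\<omega> i)) \<partial>seq_space) = (\<integral>t. f (log_tan t) \<partial>unif)"
    if [measurable]: "f \<in> borel_measurable borel" for f :: "real \<Rightarrow> real" and i
  proof -
    have "(\<integral>\<omega>. f (log_tan (\<omega> i)) \<partial>seq_space) = (\<integral>x. f x \<partial>distr seq_space borel (\<lambda>\<omega>. log_tan (\<omega> i)))"
      by (rule integral_distr[symmetric]) auto
    also have "\<dots> = (\<integral>t. f (log_tan t) \<partial>unif)"
      unfolding distr_seq_coord[OF borel_measurable_log_tan] by (rule integral_distr) auto
    finally show ?thesis .
  qed
  have "weak_conv_m (\<lambda>n. distr seq_space borel (T n)) std_normal_distribution"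
    unfolding T_def
  proof (rule seq.P.central_limit_theorem_zero_mean[OF indep_log_tan _ \<sigma>(1)])
    show "seq.P.expectation (\<lambda>\<omega>. log_tan (\<omega> n)) = 0" for n
      using integral[of "\<lambda>x. x" n] by (simp add: integral_log_tan)
    then show "seq.P.variance (\<lambda>\<omega>. log_tan (\<omega> n)) = \<sigma>\<^sup>2" for n
      using integral[of "\<lambda>x. x\<^sup>2" n] by (simp add: \<sigma>(2))
    show "distr seq_space borel (\<lambda>\<omega>. log_tan (\<omega> n)) = distr unif borel log_tan" for n
      by (rule distr_seq_coord) simp
    show "integrable seq_space (\<lambda>\<omega>. (log_tan (\<omega> n))\<^sup>2)" for n
    proof -
      have "integrable (distr seq_space borel (\<lambda>\<omega>. log_tan (\<omega> n))) (\<lambda>x. x\<^sup>2)"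
        unfolding distr_seq_coord[OF borel_measurable_log_tan]
        by (subst integrable_distr_eq) (auto simp: integrable_log_tan_power2)
      then show ?thesis by (subst (asm) integrable_distr_eq) auto
    qed
  qed
  then have cdf: "(\<lambda>n. cdf (distr seq_space borel (T n)) x) \<longlonglongrightarrow> cdf std_normal_distribution x" for x
    using isCont_cdf_std_normal by (auto simp: weak_conv_m_def weak_conv_def)
  have "\<tau> / \<sigma> < a * sqrt (2 * pi) / 2" using a \<sigma>(1) by (simp add: field_simps)
  \<comment> \<open>The room below \<open>a\<close> allows a slightly larger b, so that the
    half-open interval measured by a difference of distribution functions contains the closed
    one.\<close>
  then obtain b where b: "\<tau> / \<sigma> < b" "b < a * sqrt (2 * pi) / 2" using dense by blast
  have "0 < \<tau> / \<sigma>" using \<sigma>(1) \<open>0 < \<tau>\<close> by simp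
  with b have "0 < b" by linarith
  interpret Z: real_distribution std_normal_distribution by (rule real_dist_normal_dist)
  have "cdf std_normal_distribution b - cdf std_normal_distribution (- b) \<le> (b - (- b)) / sqrt (2 * pi)"
    using \<open>0 < b\<close> measure_std_normal_le[of "- b" b] by (subst Z.cdf_diff_eq) auto
  also have "\<dots> < a" using b(2) by (simp add: field_simps)
  finally have "\<forall>\<^sub>F n in sequentially.
      cdf (distr seq_space borel (T n)) b - cdf (distr seq_space borel (T n)) (- b) < a"
    by (intro order_tendstoD(2)[OF tendsto_diff[OF cdf cdf]])
  then show ?thesis
    using eventually_gt_at_top[of 0]
  proof eventually_elim
    case (elim n)
    interpret D: real_distribution "distr seq_space borel (T n)"
      by (intro seq.P.real_distribution_distr) simp
    have "measure seq_space {\<omega> \<in> space seq_space. \<bar>\<Sum>i<n. log_tan (\<omega> i)\<bar> \<le> \<tau> * sqrt (real n)}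
        \<le> measure seq_space (T n -` {- b<..b} \<inter> space seq_space)"
    proof (intro seq.P.finite_measure_mono subsetI)
      fix \<omega> assume "\<omega> \<in> {\<omega> \<in> space seq_space. \<bar>\<Sum>i<n. log_tan (\<omega> i)\<bar> \<le> \<tau> * sqrt (real n)}"
      then have *: "\<bar>\<Sum>i<n. log_tan (\<omega> i)\<bar> \<le> \<tau> * sqrt (real n)" "\<omega> \<in> space seq_space" by auto
      have "\<bar>T n \<omega>\<bar> = \<bar>\<Sum>i<n. log_tan (\<omega> i)\<bar> / (sqrt (real n) * \<sigma>)"
        using \<sigma>(1) by (simp add: T_def real_sqrt_mult abs_divide abs_mult)
      also have "\<dots> \<le> \<tau> * sqrt (real n) / (sqrt (real n) * \<sigma>)"
        using * \<sigma>(1) by (intro divide_right_mono) auto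
      also have "\<dots> < b" using elim(2) b(1) by simp
      finally show "\<omega> \<in> T n -` {- b<..b} \<inter> space seq_space" using *(2) by auto
    qed simp
    also have "\<dots> = measure (distr seq_space borel (T n)) {- b<..b}"
      by (rule measure_distr[symmetric]) auto
    also have "\<dots> < a" using elim(1) \<open>0 < b\<close> by (subst D.cdf_diff_eq[symmetric]) auto
    finally show ?case .
  qed
qed

lemma measure_log_tan_max_tail:
  "\<exists>C. \<forall>n s. measure seq_space {\<omega> \<in> space seq_space. \<exists>i<n. s < \<bar>log_tan (\<omega> i)\<bar>} \<le> real n * (C * exp (- s / 2))"
proof -
  obtain C where C: "\<And>s. measure unif {t. s < \<bar>log_tan t\<bar>} \<le> C * exp (- s / 2)"
    using measure_log_tan_tail by blast
  have "measure seq_space {\<omega> \<in> space seq_space. \<exists>i<n. s < \<bar>log_tan (\<omega> i)\<bar>} \<le> real n * (C * exp (- s / 2))" for n s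
  proof -
    have "{\<omega> \<in> space seq_space. \<exists>i<n. s < \<bar>log_tan (\<omega> i)\<bar>}
        = (\<Union>i<n. (\<lambda>\<omega>. log_tan (\<omega> i)) -` {x. s < \<bar>x\<bar>} \<inter> space seq_space)" by auto
    also have "measure seq_space \<dots> \<le> (\<Sum>i<n. measure seq_space ((\<lambda>\<omega>. log_tan (\<omega> i)) -` {x. s < \<bar>x\<bar>} \<inter> space seq_space))"
      by (rule seq.P.finite_measure_subadditive_finite) auto
    also have "\<dots> = (\<Sum>i<n. measure unif {t. s < \<bar>log_tan t\<bar>})"
    proof (intro sum.cong refl)
      fix i
      have "measure seq_space ((\<lambda>\<omega>. log_tan (\<omega> i)) -` {x. s < \<bar>x\<bar>} \<inter> space seq_space)
          = measure (distr seq_space borel (\<lambda>\<omega>. log_tan (\<omega> i))) {x. s < \<bar>x\<bar>}"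
        by (rule measure_distr[symmetric]) auto
      also have "\<dots> = measure unif {t. s < \<bar>log_tan t\<bar>}"
        unfolding distr_seq_coord[OF borel_measurable_log_tan]
        by (subst measure_distr) (auto simp: vimage_def)
      finally show "measure seq_space ((\<lambda>\<omega>. log_tan (\<omega> i)) -` {x. s < \<bar>x\<bar>} \<inter> space seq_space)
          = measure unif {t. s < \<bar>log_tan t\<bar>}" .
    qed
    also have "\<dots> \<le> real n * (C * exp (- s / 2))" using C[of s] by (simp add: mult_left_mono)
    finally show ?thesis .
  qed
  then show ?thesis by blast
qed

text \<open>Carries the estimates obtained on \<open>seq_space\<close> back to N phases.\<close>

lemma measure_phase_space:
  assumes "E \<in> sets (phase_space N)"
  shows "measure (phase_space N) E
    = measure seq_space ((\<lambda>\<omega>. restrict \<omega> {..<N}) -` E \<inter> space seq_space)"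
proof -
  have eq: "phase_space N = distr seq_space (PiM {..<N} (\<lambda>_. unif)) (\<lambda>\<omega>. restrict \<omega> {..<N})"
    unfolding phase_space_def by (rule seq.distr_PiM_restrict_finite[symmetric]) auto
  show ?thesis
    using assms unfolding eq by (subst measure_distr) (auto simp: measurable_restrict_subset)
qed

text \<open>From tan (pi/4) = 1, the number x = cot (pi/8) satisfies x^2 - 1 = 2 x, so x >= 2, and
  ln 2 >= 2/3.\<close>

lemma ln_cot_pi_eighth_ge: "2 / 3 \<le> ln (cos (pi/8) / sin (pi/8))"
proof -
  define s c where "s = sin (pi/8)" and "c = cos (pi/8)"
  have s: "0 < s" and c: "0 < c" unfolding s_def c_def by (auto intro!: sin_gt_zero cos_gt_zero)
  have "sin (pi/4) = 2 * s * c" "cos (pi/4) = c\<^sup>2 - s\<^sup>2"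
    using sin_double[of "pi/8"] cos_double[of "pi/8"] by (simp_all add: s_def c_def)
  moreover have "sin (pi/4) = cos (pi/4)" by (simp only: sin_45 cos_45)
  ultimately have "c\<^sup>2 - s\<^sup>2 = 2 * s * c" by (simp only:)
  then have "2 * s * c \<le> c * c" using zero_le_power2[of s] by (simp only: power2_eq_square)
  then have "2 \<le> c / s" using s c by (simp add: field_simps)
  then have "ln 2 \<le> ln (c / s)" by simp
  then show ?thesis using ln2_ge_two_thirds unfolding s_def c_def by linarith
qed

theorem mainTheorem16:
  fixes \<epsilon> :: real
  assumes "0 < \<epsilon>" and "\<epsilon> < 1"
  shows "\<exists>N0. \<forall>N\<ge>N0.
    measure (phase_space N)
      {\<theta> \<in> space (phase_space N).
         lambda1 N \<theta> \<le> 4 * (real N)^2 *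
           exp (- sqrt (ln (cos (pi/8) / sin (pi/8)) * pi) * \<epsilon> * sqrt (real N) / 2)}
    \<ge> 1 - \<epsilon>"
proof -
  define \<gamma> where "\<gamma> = ln (cos (pi/8) / sin (pi/8))"
  define K where "K = sqrt (\<gamma> * pi) * \<epsilon> / 4"
  define \<sigma> where "\<sigma> = sqrt (\<integral>t. (log_tan t)\<^sup>2 \<partial>unif)"
  have \<gamma>: "2 / 3 \<le> \<gamma>" unfolding \<gamma>_def by (rule ln_cot_pi_eighth_ge)
  have K: "0 < K" using \<gamma> assms(1) by (simp add: K_def)
  have "\<gamma>\<^sup>2 / 4 \<le> (\<integral>t. (log_tan t)\<^sup>2 \<partial>unif)"
    using integral_log_tan_power2_ge by (simp add: \<gamma>_def)
  then have \<sigma>: "\<gamma> / 2 \<le> \<sigma>"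
    unfolding \<sigma>_def by (intro real_le_rsqrt) (simp add: power_divide)
  with \<gamma> have \<sigma>_pos: "0 < \<sigma>" by linarith
  have \<sigma>_sq: "\<sigma>\<^sup>2 = (\<integral>t. (log_tan t)\<^sup>2 \<partial>unif)"
    unfolding \<sigma>_def by (intro real_sqrt_pow2 Bochner_Integration.integral_nonneg) simp
  \<comment> \<open>With sigma >= gamma / 2 this reduces to gamma > 81/128, and 2/3 exceeds 81/128.
    That is why 9/8 is affordable.\<close>
  have "2 * (9 / 8 * K) / (\<sigma> * sqrt (2 * pi)) < \<epsilon>"
  proof -
    have "(9 / 16)\<^sup>2 * \<gamma> < (\<gamma> / 2)\<^sup>2 * 2"
    proof -
      have "(2 / 3) * \<gamma> \<le> \<gamma> * \<gamma>" using \<gamma> by (intro mult_right_mono) auto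
      then show ?thesis using \<gamma> by (simp add: power2_eq_square)
    qed
    then have "sqrt ((9 / 16)\<^sup>2 * \<gamma>) < sqrt ((\<gamma> / 2)\<^sup>2 * 2)" by simp
    then have "9 / 16 * sqrt \<gamma> < \<gamma> / 2 * sqrt 2"
      using \<gamma> by (simp add: real_sqrt_mult)
    also have "\<dots> \<le> \<sigma> * sqrt 2" using \<sigma> by (intro mult_right_mono) auto
    finally have "9 / 16 * sqrt \<gamma> * (sqrt pi * \<epsilon>) < \<sigma> * sqrt 2 * (sqrt pi * \<epsilon>)"
      using assms(1) by (intro mult_strict_right_mono) auto
    then have "2 * (9 / 8 * K) < \<epsilon> * (\<sigma> * sqrt (2 * pi))"
      by (simp add: K_def real_sqrt_mult mult_ac)
    then show ?thesis using \<sigma>_pos by (simp add: divide_less_eq)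
  qed
  \<comment> \<open>The failure probability eps is shared: \<open>a\<close> for a small sum,
    \<open>\<epsilon> - a\<close> for a large single term.\<close>
  then obtain a where a: "2 * (9 / 8 * K) / (\<sigma> * sqrt (2 * pi)) < a" "a < \<epsilon>" using dense by blast
  obtain C where C: "\<And>n s. measure seq_space {\<omega> \<in> space seq_space. \<exists>i<n. s < \<bar>log_tan (\<omega> i)\<bar>}
      \<le> real n * (C * exp (- s / 2))"
    using measure_log_tan_max_tail by blast
  have "(\<lambda>n. real n * (C * exp (- (K / 8 * sqrt (real n)) / 2))) \<longlonglongrightarrow> 0"
    using K by real_asymp
  then have "\<forall>\<^sub>F n in sequentially. real n * (C * exp (- (K / 8 * sqrt (real n)) / 2)) < \<epsilon> - a"
    using a(2) by (intro order_tendstoD) auto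
  moreover have "\<forall>\<^sub>F n in sequentially. measure seq_space
      {\<omega> \<in> space seq_space. \<bar>\<Sum>i<n. log_tan (\<omega> i)\<bar> \<le> 9 / 8 * K * sqrt (real n)} < a"
    using K a(1) by (intro log_tan_sum_anticoncentration[OF \<sigma>_pos \<sigma>_sq]) auto
  \<comment> \<open>Here \<open>2 K \<surd>N\<close> is the exponent to be reached; the excess \<open>2 (9/8) K - 2 K = K / 4\<close> pays for
    the factor \<open>exp (2 max |X\<^sub>q|)\<close> in \<open>lambda1_le_exp\<close>.\<close>
  ultimately have "\<forall>\<^sub>F N in sequentially. measure (phase_space N)
      {\<theta> \<in> space (phase_space N).
         lambda1 N \<theta> \<le> 4 * (real N)^2 * exp (- sqrt (\<gamma> * pi) * \<epsilon> * sqrt (real N) / 2)} \<ge> 1 - \<epsilon>"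
    using eventually_gt_at_top[of 0]
  proof eventually_elim
    case (elim N)
    define E where "E = {\<theta> \<in> space (phase_space N).
        lambda1 N \<theta> \<le> 4 * (real N)^2 * exp (- sqrt (\<gamma> * pi) * \<epsilon> * sqrt (real N) / 2)}"
    define B1 where "B1 = {\<omega> \<in> space seq_space. \<bar>\<Sum>i<N. log_tan (\<omega> i)\<bar> \<le> 9 / 8 * K * sqrt (real N)}"
    define B2 where "B2 = {\<omega> \<in> space seq_space. \<exists>i<N. K / 8 * sqrt (real N) < \<bar>log_tan (\<omega> i)\<bar>}"
    define E' where "E' = (\<lambda>\<omega>. restrict \<omega> {..<N}) -` E \<inter> space seq_space"
    have E: "E \<in> sets (phase_space N)"
      unfolding E_def using borel_measurable_lambda1[OF elim(3)] by measurable
    have E': "E' \<in> sets seq_space"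
      unfolding E'_def using E
      by (intro measurable_sets[of _ seq_space "phase_space N"])
         (auto simp: phase_space_def intro!: measurable_restrict_subset)
    have [measurable]: "B1 \<in> sets seq_space" "B2 \<in> sets seq_space"
      unfolding B1_def B2_def by measurable
    have "AE \<omega> in seq_space. \<forall>q\<in>{..<N}. 0 \<le> \<omega> q \<and> \<omega> q \<le> 1 \<and> \<omega> q \<notin> {0, 1 / 2, 1}"
      by (intro eventually_ball_finite ballI AE_PiM_component[where M="\<lambda>_. unif"]
            prob_space_unif AE_unif_regular) auto
    \<comment> \<open>Almost surely, failure of the eigenvalue bound forces a small sum
      (\<open>B1\<close>) or a large term (\<open>B2\<close>).\<close>
    then have "AE \<omega> in seq_space. \<omega> \<in> E' \<union> (B1 \<union> B2)"
      using AE_space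
    proof eventually_elim
      case (elim \<omega>)
      show ?case
      proof (rule ccontr)
        assume "\<not> ?case"
        then have \<omega>: "\<omega> \<notin> E'" "\<omega> \<notin> B1" "\<omega> \<notin> B2" by auto
        define S where "S = (\<Sum>i<N. log_tan (\<omega> i))"
        have "lambda1 N (restrict \<omega> {..<N})
            \<le> 2 * real N * exp (2 * (K / 8 * sqrt (real N))) * exp (- 2 * \<bar>\<Sum>q<N. log_tan (restrict \<omega> {..<N} q)\<bar>)"
        proof (intro lambda1_le_exp \<open>0 < N\<close>)
          fix q assume q: "q < N"
          then show "0 \<le> restrict \<omega> {..<N} q \<and> restrict \<omega> {..<N} q \<le> 1 \<and> restrict \<omega> {..<N} q \<notin> {0, 1 / 2, 1}"
            using elim(1) by simp
          have "\<not> K / 8 * sqrt (real N) < \<bar>log_tan (\<omega> q)\<bar>"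
            using \<omega>(3) elim(2) q unfolding B2_def by blast
          then show "\<bar>log_tan (restrict \<omega> {..<N} q)\<bar> \<le> K / 8 * sqrt (real N)"
            using q by (simp add: not_less)
        qed
        also have "(\<Sum>q<N. log_tan (restrict \<omega> {..<N} q)) = S" by (simp add: S_def)
        also have "2 * real N * exp (2 * (K / 8 * sqrt (real N))) * exp (- 2 * \<bar>S\<bar>)
            = 2 * real N * exp (2 * (K / 8 * sqrt (real N)) + - 2 * \<bar>S\<bar>)"
          by (simp only: mult.assoc exp_add)
        also have "\<dots> \<le> 4 * (real N)^2 * exp (- sqrt (\<gamma> * pi) * \<epsilon> * sqrt (real N) / 2)"
        proof (rule mult_mono)
          have "1 \<le> real N" using \<open>0 < N\<close> by simp
          \<comment> \<open>The argument yields a linear prefactor; it is relaxed to the quadratic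
            one claimed.\<close>
          then show "2 * real N \<le> 4 * (real N)^2" by (simp add: power2_eq_square)
          have "9 / 8 * K * sqrt (real N) < \<bar>S\<bar>" using \<omega>(2) elim by (simp add: B1_def S_def)
          then have "2 * (K / 8 * sqrt (real N)) + - 2 * \<bar>S\<bar> \<le> - 2 * (K * sqrt (real N))" by simp
          also have "\<dots> = - sqrt (\<gamma> * pi) * \<epsilon> * sqrt (real N) / 2" by (simp add: K_def)
          finally show "exp (2 * (K / 8 * sqrt (real N)) + - 2 * \<bar>S\<bar>)
              \<le> exp (- sqrt (\<gamma> * pi) * \<epsilon> * sqrt (real N) / 2)" by simp
        qed auto
        finally have "lambda1 N (restrict \<omega> {..<N})
            \<le> 4 * (real N)^2 * exp (- sqrt (\<gamma> * pi) * \<epsilon> * sqrt (real N) / 2)" .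
        moreover have "restrict \<omega> {..<N} \<in> space (phase_space N)"
          by (simp add: phase_space_def space_PiM)
        ultimately have "restrict \<omega> {..<N} \<in> E" unfolding E_def by blast
        then show False using \<omega>(1) elim(2) by (simp add: E'_def)
      qed
    qed
    then have "measure seq_space (E' \<union> (B1 \<union> B2)) = 1"
      using E' by (subst seq.P.prob_eq_1) auto
    then have "1 = measure seq_space (E' \<union> (B1 \<union> B2))" by (rule sym)
    also have "\<dots> \<le> measure seq_space E' + (measure seq_space B1 + measure seq_space B2)"
    proof -
      have "measure seq_space (E' \<union> (B1 \<union> B2)) \<le> measure seq_space E' + measure seq_space (B1 \<union> B2)"
        using E' by (intro measure_Un_le) auto
      moreover have "measure seq_space (B1 \<union> B2) \<le> measure seq_space B1 + measure seq_space B2"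
        by (intro measure_Un_le) auto
      ultimately show ?thesis by linarith
    qed
    also have "measure seq_space E' = measure (phase_space N) E"
      unfolding E'_def by (rule measure_phase_space[OF E, symmetric])
    finally have "1 - \<epsilon> \<le> measure (phase_space N) E"
      using elim(1,2) C[of N "K / 8 * sqrt (real N)"] unfolding B1_def B2_def by linarith
    then show ?case by (simp add: E_def)
  qed
  then show ?thesis unfolding \<gamma>_def eventually_sequentially .
qed

end
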